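(* There exist universal constants $C,R>0$ such that for every $n\ge1$, every finite $n$-player game with losses in $[0,1]$, every $\eta>0$, every player $i$ and every integer $k\ge1$, the weighted-gap vectors $h_i^t$ of Optimistic Hedge self-play with common constant step size $\eta$ satisfy $$\sup_{t\ge k+2}\|\Delta^kh_i^t\|_2\le C(R\sqrt n\,\eta)^k\,k!.$$
   Context: Game. There are $n$ players; player $i\in[n]$ has action set $A_i=[d_i]=\{1,\dots,d_i\}$, $A=\prod_j A_j$, $A_{-i}=\prod_{j\ne i}A_j$, and loss function $\ell_i:A\to[0,1]$. For mixed strategies $x_j\in\Delta_{d_j}$ (the probability simplex in $\mathbb R^{d_j}$), the expected loss vector is $\ell_i(x_{-i})\in[0,1]^{d_i}$ with $[\ell_i(x_{-i})]_{a_i}=\sum_{a_{-i}\in A_{-i}}\ell_i(a_i,a_{-i})\prod_{j\ne i}x_{j,a_j}$. Optimistic Hedge self-play with step size $\eta>0$ (run for all rounds $t\ge1$). For every player $i$: $x_i^1$ is uniform on $A_i$, $\ell_i^0=0\in\mathbb R^{d_i}$, and for every $t\ge1$, $\ell_i^t=\ell_i(x_{-i}^t)$ and $$x_{i,a}^{t+1}=\frac{x_{i,a}^t\exp\{-\eta(2\ell_{i,a}^t-\ell_{i,a}^{t-1})\}}{\sum_{b\in A_i}x_{i,b}^t\exp\{-\eta(2\ell_{i,b}^t-\ell_{i,b}^{t-1})\}},\qquad a\in A_i.$$ Weighted-gap vector: $h_i^t\in\mathbb R^{\binom{d_i}{2}}$ for $t\ge1$, indexed by pairs $a<b$ in $A_i$,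 with $[h_i^t]_{ab}=\sqrt{x_{i,a}^tx_{i,b}^t}\,(\ell_{i,a}^{t-1}-\ell_{i,b}^{t-1})$. Finite differences in time: $\Delta^0y^t=y^t$, $\Delta y^t=y^{t+1}-y^t$, $\Delta^{k+1}y^t=\Delta(\Delta^ky^t)$. "Universal constant" means an absolute constant, independent of $n$, the $d_j$, the losses, the player, $k$ and $\eta$. *)

theory Defs
  imports "HOL-Analysis.Analysis"
begin

text \<open>
  A finite game has players \<open>{1..n}\<close>; player \<open>j\<close> has actions \<open>{1..d j}\<close>. A pure profile is an
  element of the extensional product \<open>PiE {1..n} (\<lambda>j. {1..d j})\<close>, and \<open>L i p\<close> is the loss of
  player \<open>i\<close> under \<open>p\<close>. A mixed profile \<open>x\<close> assigns the probability \<open>x j a\<close> to action \<open>a\<close> of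
  player \<open>j\<close>; only values at \<open>j \<in> {1..n}\<close>, \<open>a \<in> {1..d j}\<close> are meaningful.
\<close>

definition is_game :: "nat \<Rightarrow> (nat \<Rightarrow> nat) \<Rightarrow> (nat \<Rightarrow> (nat \<Rightarrow> nat) \<Rightarrow> real) \<Rightarrow> bool" where
  "is_game n d L \<longleftrightarrow>
     n \<ge> 1 \<and> (\<forall>i\<in>{1..n}. d i \<ge> 1) \<and>
     (\<forall>i\<in>{1..n}. \<forall>p\<in>PiE {1..n} (\<lambda>j. {1..d j}). L i p \<in> {0..1})"

definition expected_loss ::
  "nat \<Rightarrow> (nat \<Rightarrow> nat) \<Rightarrow> (nat \<Rightarrow> (nat \<Rightarrow> nat) \<Rightarrow> real) \<Rightarrow> (nat \<Rightarrow> nat \<Rightarrow> real) \<Rightarrow> nat \<Rightarrow> nat \<Rightarrow> real"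
where
  "expected_loss n d L x i a =
     (\<Sum>p\<in>PiE ({1..n} - {i}) (\<lambda>j. {1..d j}). L i (p(i := a)) * (\<Prod>j\<in>{1..n} - {i}. x j (p j)))"

text \<open>
  Rounds are numbered from 1. The value of \<open>oh_strategy\<close> at round 0 is a dummy on which nothing
  depends, whereas \<open>oh_loss\<close> at round 0 is the prescribed initial vector 0.
\<close>

function (sequential)
  oh_strategy ::
    "nat \<Rightarrow> (nat \<Rightarrow> nat) \<Rightarrow> (nat \<Rightarrow> (nat \<Rightarrow> nat) \<Rightarrow> real) \<Rightarrow> real \<Rightarrow> nat \<Rightarrow> nat \<Rightarrow> nat \<Rightarrow> real" and
  oh_loss ::
    "nat \<Rightarrow> (nat \<Rightarrow> nat) \<Rightarrow> (nat \<Rightarrow> (nat \<Rightarrow> nat) \<Rightarrow> real) \<Rightarrow> real \<Rightarrow> nat \<Rightarrow> nat \<Rightarrow> nat \<Rightarrow> real"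
where
  "oh_strategy n d L \<eta> 0 = (\<lambda>i a. 0)"
| "oh_strategy n d L \<eta> (Suc 0) = (\<lambda>i a. 1 / real (d i))"
| "oh_strategy n d L \<eta> (Suc (Suc t)) = (\<lambda>i a.
     oh_strategy n d L \<eta> (Suc t) i a *
       exp (- \<eta> * (2 * oh_loss n d L \<eta> (Suc t) i a - oh_loss n d L \<eta> t i a)) /
     (\<Sum>b\<in>{1..d i}. oh_strategy n d L \<eta> (Suc t) i b *
       exp (- \<eta> * (2 * oh_loss n d L \<eta> (Suc t) i b - oh_loss n d L \<eta> t i b))))"
| "oh_loss n d L \<eta> 0 = (\<lambda>i a. 0)"
| "oh_loss n d L \<eta> (Suc t) = expected_loss n d L (oh_strategy n d L \<eta> (Suc t))"
  by pat_completeness auto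
termination
  by (relation "Wellfounded.measure (case_sum (\<lambda>(n, d, L, \<eta>, t). 2 * t) (\<lambda>(n, d, L, \<eta>, t). 2 * t + 1))") auto

text \<open>
  The vector is represented as a function on all pairs; its norm is taken over \<open>action_pairs\<close>.
  The definition is meant for \<open>t \<ge> 1\<close>.
\<close>

definition weighted_gap ::
  "nat \<Rightarrow> (nat \<Rightarrow> nat) \<Rightarrow> (nat \<Rightarrow> (nat \<Rightarrow> nat) \<Rightarrow> real) \<Rightarrow> real \<Rightarrow> nat \<Rightarrow> nat \<Rightarrow> nat \<times> nat \<Rightarrow> real"
where
  "weighted_gap n d L \<eta> i t = (\<lambda>(a, b).
     sqrt (oh_strategy n d L \<eta> t i a * oh_strategy n d L \<eta> t i b) *
     (oh_loss n d L \<eta> (t - 1) i a - oh_loss n d L \<eta> (t - 1) i b))"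

definition action_pairs :: "(nat \<Rightarrow> nat) \<Rightarrow> nat \<Rightarrow> (nat \<times> nat) set" where
  "action_pairs d i = {(a, b). a \<in> {1..d i} \<and> b \<in> {1..d i} \<and> a < b}"

text \<open>For function-valued \<open>y\<close>, subtraction is pointwise. Iterates are \<open>(fdiff ^^ k) y\<close>.\<close>

definition fdiff :: "(nat \<Rightarrow> 'a::minus) \<Rightarrow> nat \<Rightarrow> 'a" where
  "fdiff y t = y (t + 1) - y t"

end

theory Submission
  imports Defs
begin

text \<open>
  Fix a round \<open>t\<close> and look at the window of rounds \<open>t..t+K\<close>. Sequences on a window form a Banach
  algebra under the norm \<open>\<Sum>k\<le>K. sup |\<Delta>\<^sup>k f| \<rho>\<^sup>k / k!\<close>, by the Leibniz rule. Let \<open>V\<close> be the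
  log-weights accumulated since round \<open>t\<close>. Since \<open>\<Delta>V\<close> is \<open>\<eta>\<close> times losses, and the losses are an
  analytic function of \<open>V\<close>, an induction on \<open>K\<close> at the fixed radius \<open>\<rho> = 1 / (192 \<surd>n \<eta>)\<close> keeps the
  norm of \<open>V\<close> below \<open>1 / (16 \<surd>n)\<close> as long as \<open>64 \<surd>n \<eta> K \<le> 1\<close>. For larger orders \<open>k\<close> the trivial
  bound \<open>2\<^sup>k\<close> is good enough.

  The factor \<open>\<surd>n\<close> instead of \<open>n\<close> is due to orthogonality. Write the strategy of player \<open>j\<close> as
  \<open>x\<^sub>j (1 + \<delta>\<^sub>j)\<close> relative to its value \<open>x\<^sub>j\<close> at round \<open>t\<close>. The \<open>\<delta>\<^sub>j\<close> have mean zero under \<open>x\<^sub>j\<close>, so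
  the terms of the expansion of \<open>\<Prod>j. 1 + \<delta>\<^sub>j\<close> over sets of players are orthogonal in
  \<open>L\<^sup>2\<close> of the product distribution, and the \<open>n choose m\<close> terms of size \<open>m\<close> contribute only
  \<open>sqrt (n choose m)\<close> times the size of one of them.
\<close>

section \<open>Finite differences\<close>

lemma fdiff_pow_Suc: "(fdiff ^^ Suc k) f s = (fdiff ^^ k) f (s + 1) - (fdiff ^^ k) f s"
  by (simp add: fdiff_def)

lemma fdiff_pow_Suc': "(fdiff ^^ Suc k) f = (fdiff ^^ k) (fdiff f)"
  by (simp add: funpow_swap1)

lemma fdiff_pow_shift: "(fdiff ^^ k) (\<lambda>s. f (s + t)) s = (fdiff ^^ k) f (s + t)"
  by (induction k arbitrary: s) (simp_all only: fdiff_pow_Suc, simp_all add: add_ac)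

lemma fdiff_pow_apply: "(fdiff ^^ k) f s a = (fdiff ^^ k) (\<lambda>r. f r a) s"
  by (induction k arbitrary: s) (simp_all only: fdiff_pow_Suc, simp_all)

lemma fdiff_pow_add:
  fixes f g :: "nat \<Rightarrow> real"
  shows "(fdiff ^^ k) (\<lambda>s. f s + g s) s = (fdiff ^^ k) f s + (fdiff ^^ k) g s"
  by (induction k arbitrary: s) (simp_all only: fdiff_pow_Suc, simp_all)

lemma fdiff_pow_cmult:
  fixes f :: "nat \<Rightarrow> real"
  shows "(fdiff ^^ k) (\<lambda>s. c * f s) s = c * (fdiff ^^ k) f s"
  by (induction k arbitrary: s) (simp_all only: fdiff_pow_Suc, simp_all add: algebra_simps)

lemma fdiff_pow_zero: "(fdiff ^^ k) (\<lambda>s. 0 :: real) s = 0"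
  using fdiff_pow_cmult[of k 0 "\<lambda>s. 0"] by simp

lemma fdiff_pow_sum:
  fixes f :: "'i \<Rightarrow> nat \<Rightarrow> real"
  shows "(fdiff ^^ k) (\<lambda>s. \<Sum>i\<in>I. c i * f i s) s = (\<Sum>i\<in>I. c i * (fdiff ^^ k) (f i) s)"
  by (induction I rule: infinite_finite_induct)
     (simp_all add: fdiff_pow_zero fdiff_pow_add fdiff_pow_cmult)

text \<open>The \<open>k\<close>-th difference at \<open>s\<close> reads only the values at
  \<open>s\<close> to \<open>s + k\<close>, so convergence on that range suffices and no uniformity
  in \<open>r\<close> is needed.\<close>

lemma fdiff_pow_sums:
  fixes f :: "nat \<Rightarrow> nat \<Rightarrow> real"
  assumes "\<And>r. r \<le> s + k \<Longrightarrow> (\<lambda>m. f m r) sums g r"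
  shows "(\<lambda>m. (fdiff ^^ k) (f m) s) sums (fdiff ^^ k) g s"
  using assms
proof (induction k arbitrary: s)
  case (Suc k)
  show ?case
    unfolding fdiff_pow_Suc by (rule sums_diff[OF Suc.IH Suc.IH]) (use Suc.prems in auto)
qed simp

text \<open>The discrete Leibniz rule, by induction with Pascal's rule. The second factor is shifted
  by \<open>j\<close>, but since \<open>j + (k - j) = k\<close> nothing beyond \<open>s + k\<close>
  is read, so the rule stays inside a window.\<close>

lemma fdiff_pow_mult:
  fixes f g :: "nat \<Rightarrow> real"
  shows "(fdiff ^^ k) (\<lambda>s. f s * g s) s =
    (\<Sum>j\<le>k. real (k choose j) * (fdiff ^^ j) f s * (fdiff ^^ (k - j)) g (s + j))"
proof (induction k arbitrary: s)
  case (Suc k)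
  let ?F = "\<lambda>j. (fdiff ^^ j) f s" and ?G = "\<lambda>j r. (fdiff ^^ j) g (s + r)"
  have "(fdiff ^^ Suc k) (\<lambda>s. f s * g s) s =
      (\<Sum>j\<le>k. real (k choose j) *
        (?F (Suc j) * ?G (Suc k - Suc j) (Suc j) + ?F j * ?G (Suc k - j) j))"
    unfolding fdiff_pow_Suc[of k "\<lambda>s. f s * g s"] Suc sum_subtractf[symmetric]
  proof (intro sum.cong refl)
    fix j assume "j \<in> {..k}"
    then have 1: "?G (Suc k - j) j = ?G (k - j) (Suc j) - ?G (k - j) j"
      by (simp add: Suc_diff_le fdiff_def)
    have 2: "?F (Suc j) = (fdiff ^^ j) f (s + 1) - ?F j"
      by (simp add: fdiff_def)
    show "real (k choose j) * (fdiff ^^ j) f (s + 1) * (fdiff ^^ (k - j)) g (s + 1 + j) -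
        real (k choose j) * ?F j * ?G (k - j) j =
        real (k choose j) * (?F (Suc j) * ?G (Suc k - Suc j) (Suc j) + ?F j * ?G (Suc k - j) j)"
      by (simp only: 1 2 diff_Suc_Suc) (simp add: algebra_simps)
  qed
  also have "\<dots> = (\<Sum>j\<le>k. real (k choose j) * ?F (Suc j) * ?G (Suc k - Suc j) (Suc j)) +
      (\<Sum>j\<le>k. real (k choose j) * ?F j * ?G (Suc k - j) j)"
    by (simp add: sum.distrib algebra_simps)
  also have "(\<Sum>j\<le>k. real (k choose j) * ?F j * ?G (Suc k - j) j) =
      (\<Sum>j\<le>Suc k. real (k choose j) * ?F j * ?G (Suc k - j) j)"
    by simp
  also have "\<dots> = ?F 0 * ?G (Suc k) 0 +
      (\<Sum>j\<le>k. real (k choose Suc j) * ?F (Suc j) * ?G (Suc k - Suc j) (Suc j))"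
    by (subst sum.atMost_Suc_shift) simp
  finally show ?case
    by (subst sum.atMost_Suc_shift) (simp add: sum.distrib algebra_simps)
qed simp

section \<open>A submultiplicative norm on windows\<close>

text \<open>The constraint \<open>s + k \<le> K\<close> admits exactly the differences that read
  only the values at \<open>0\<close> to \<open>K\<close>. The scaling is that of a Taylor
  coefficient at radius \<open>\<rho>\<close>.\<close>

definition fdiff_majorant :: "nat \<Rightarrow> real \<Rightarrow> (nat \<Rightarrow> real) \<Rightarrow> (nat \<Rightarrow> real) \<Rightarrow> bool" where
  "fdiff_majorant K \<rho> f \<alpha> \<longleftrightarrow> (\<forall>k s. s + k \<le> K \<longrightarrow> \<bar>(fdiff ^^ k) f s\<bar> * \<rho> ^ k / fact k \<le> \<alpha> k)"

text \<open>
  A common majorant for the whole family \<open>I\<close>: uniformity in the index is what makes the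
  \<open>L\<^sup>2\<close> argument for products over sets of players work.
\<close>

definition fdiff_bound :: "nat \<Rightarrow> real \<Rightarrow> 'i set \<Rightarrow> ('i \<Rightarrow> nat \<Rightarrow> real) \<Rightarrow> real \<Rightarrow> bool" where
  "fdiff_bound K \<rho> I f c \<longleftrightarrow>
     (\<exists>\<alpha>. (\<forall>k. 0 \<le> \<alpha> k) \<and> (\<forall>i\<in>I. fdiff_majorant K \<rho> (f i) \<alpha>) \<and> (\<Sum>k\<le>K. \<alpha> k) \<le> c)"

lemma fdiff_boundE:
  assumes "fdiff_bound K \<rho> I f c"
  obtains \<alpha> where "\<And>k. 0 \<le> \<alpha> k" "\<And>i. i \<in> I \<Longrightarrow> fdiff_majorant K \<rho> (f i) \<alpha>" "(\<Sum>k\<le>K. \<alpha> k) \<le> c"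
  using assms unfolding fdiff_bound_def by blast

lemma fdiff_boundI:
  assumes "\<And>k. 0 \<le> \<alpha> k" "\<And>i. i \<in> I \<Longrightarrow> fdiff_majorant K \<rho> (f i) \<alpha>" "(\<Sum>k\<le>K. \<alpha> k) \<le> c"
  shows "fdiff_bound K \<rho> I f c"
  using assms unfolding fdiff_bound_def by blast

lemma fdiff_bound_nonneg: "fdiff_bound K \<rho> I f c \<Longrightarrow> 0 \<le> c"
  by (erule fdiff_boundE) (meson order_trans sum_nonneg)

lemma fdiff_bound_mono: "fdiff_bound K \<rho> I f c \<Longrightarrow> c \<le> c' \<Longrightarrow> fdiff_bound K \<rho> I f c'"
  unfolding fdiff_bound_def by (meson order_trans)

lemma fdiff_bound_reindex:
  assumes "fdiff_bound K \<rho> I f c" "\<And>j. j \<in> J \<Longrightarrow> h j \<in> I"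
    "\<And>j s. j \<in> J \<Longrightarrow> g j s = f (h j) s"
  shows "fdiff_bound K \<rho> J g c"
proof -
  have "g j = f (h j)" if "j \<in> J" for j
    using assms(3)[OF that] by auto
  then show ?thesis
    using assms(1,2) unfolding fdiff_bound_def by metis
qed

text \<open>An analogue of Cauchy's estimate: it recovers factorial growth from the norm, because a
  single nonnegative coefficient is at most the sum of all of them.\<close>

lemma fdiff_bound_le:
  assumes "fdiff_bound K \<rho> I f c" "i \<in> I" "s + k \<le> K" "\<rho> > 0"
  shows "\<bar>(fdiff ^^ k) (f i) s\<bar> \<le> c * fact k / \<rho> ^ k"
proof -
  obtain \<alpha> where a: "\<And>k. 0 \<le> \<alpha> k" "\<And>i. i \<in> I \<Longrightarrow> fdiff_majorant K \<rho> (f i) \<alpha>" "(\<Sum>k\<le>K. \<alpha> k) \<le> c"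
    using fdiff_boundE[OF assms(1)] by metis
  have "\<bar>(fdiff ^^ k) (f i) s\<bar> * \<rho> ^ k / fact k \<le> \<alpha> k"
    using a(2)[OF assms(2)] assms(3) unfolding fdiff_majorant_def by blast
  also have "\<dots> \<le> (\<Sum>k\<le>K. \<alpha> k)"
    by (rule member_le_sum) (use a(1) assms(3) in auto)
  finally have "\<bar>(fdiff ^^ k) (f i) s\<bar> * \<rho> ^ k / fact k \<le> c"
    using a(3) by simp
  then show ?thesis
    using assms(4) by (simp add: field_simps)
qed

lemma fdiff_bound_const:
  assumes "\<And>i s. i \<in> I \<Longrightarrow> f i s = c"
  shows "fdiff_bound K \<rho> I f \<bar>c\<bar>"
proof (rule fdiff_boundI[where \<alpha> = "\<lambda>k. if k = 0 then \<bar>c\<bar> else 0"])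
  fix i assume "i \<in> I"
  then have f: "f i = (\<lambda>s. c)"
    using assms by auto
  have "fdiff (\<lambda>s. c) = (\<lambda>s. 0)"
    by (simp add: fdiff_def fun_eq_iff)
  then have d: "(fdiff ^^ Suc k) (\<lambda>s. c) s = 0" for k s
    unfolding fdiff_pow_Suc' by (simp only: fdiff_pow_zero)
  have "\<bar>(fdiff ^^ k) (\<lambda>s. c) s\<bar> * \<rho> ^ k / fact k \<le> (if k = 0 then \<bar>c\<bar> else 0)" for k s
    using d by (cases k) auto
  then show "fdiff_majorant K \<rho> (f i) (\<lambda>k. if k = 0 then \<bar>c\<bar> else 0)"
    unfolding f fdiff_majorant_def by blast
qed (simp_all)

lemma fdiff_bound_add:
  assumes "fdiff_bound K \<rho> I f b" "fdiff_bound K \<rho> I g c" "\<rho> > 0"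
  shows "fdiff_bound K \<rho> I (\<lambda>i s. f i s + g i s) (b + c)"
proof -
  obtain \<alpha> where a: "\<And>k. 0 \<le> \<alpha> k" "\<And>i. i \<in> I \<Longrightarrow> fdiff_majorant K \<rho> (f i) \<alpha>" "(\<Sum>k\<le>K. \<alpha> k) \<le> b"
    using fdiff_boundE[OF assms(1)] by metis
  obtain \<beta> where b: "\<And>k. 0 \<le> \<beta> k" "\<And>i. i \<in> I \<Longrightarrow> fdiff_majorant K \<rho> (g i) \<beta>" "(\<Sum>k\<le>K. \<beta> k) \<le> c"
    using fdiff_boundE[OF assms(2)] by metis
  show ?thesis
  proof (rule fdiff_boundI[where \<alpha> = "\<lambda>k. \<alpha> k + \<beta> k"])
    fix i assume i: "i \<in> I"
    show "fdiff_majorant K \<rho> (\<lambda>s. f i s + g i s) (\<lambda>k. \<alpha> k + \<beta> k)"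
      unfolding fdiff_majorant_def
    proof (intro allI impI)
      fix k s assume "s + k \<le> K"
      then have 1: "\<bar>(fdiff ^^ k) (f i) s\<bar> * \<rho> ^ k / fact k \<le> \<alpha> k"
          "\<bar>(fdiff ^^ k) (g i) s\<bar> * \<rho> ^ k / fact k \<le> \<beta> k"
        using a(2)[OF i] b(2)[OF i] unfolding fdiff_majorant_def by blast+
      have "\<bar>(fdiff ^^ k) (f i) s + (fdiff ^^ k) (g i) s\<bar> * \<rho> ^ k / fact k \<le>
          (\<bar>(fdiff ^^ k) (f i) s\<bar> + \<bar>(fdiff ^^ k) (g i) s\<bar>) * \<rho> ^ k / fact k"
        using assms(3) by (intro divide_right_mono mult_right_mono) auto
      with 1 show "\<bar>(fdiff ^^ k) (\<lambda>s. f i s + g i s) s\<bar> * \<rho> ^ k / fact k \<le> \<alpha> k + \<beta> k"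
        unfolding fdiff_pow_add by (simp add: field_simps)
    qed
  qed (use a b in \<open>auto simp: sum.distrib intro: add_nonneg_nonneg\<close>)
qed

text \<open>The pairs \<open>(i, j)\<close> with \<open>i + j \<le> K\<close> form a triangle inside
  the square \<open>{..K} \<times> {..K}\<close>, and all terms are nonnegative.\<close>

lemma sum_convolution_le:
  fixes \<alpha> \<beta> :: "nat \<Rightarrow> real"
  assumes "\<And>k. 0 \<le> \<alpha> k" "\<And>k. 0 \<le> \<beta> k"
  shows "(\<Sum>k\<le>K. \<Sum>j\<le>k. \<alpha> j * \<beta> (k - j)) \<le> (\<Sum>k\<le>K. \<alpha> k) * (\<Sum>k\<le>K. \<beta> k)"
proof -
  have "(\<Sum>k\<le>K. \<Sum>j\<le>k. \<alpha> j * \<beta> (k - j)) = (\<Sum>(i, j)\<in>{(i, j). i + j \<le> K}. \<alpha> i * \<beta> j)"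
    by (simp add: sum.triangle_reindex_eq)
  also have "\<dots> \<le> (\<Sum>(i, j)\<in>{..K} \<times> {..K}. \<alpha> i * \<beta> j)"
    by (rule sum_mono2) (use assms in auto)
  also have "\<dots> = (\<Sum>k\<le>K. \<alpha> k) * (\<Sum>k\<le>K. \<beta> k)"
    by (simp add: sum_product sum.cartesian_product)
  finally show ?thesis .
qed

text \<open>Division by \<open>fact k\<close> turns the binomial coefficients of the Leibniz rule
  into \<open>1 / (fact j * fact (k - j))\<close>, so the convolution of two majorants is a majorant
  of the product. The shift by \<open>j\<close> is harmless because majorants are uniform in the
  starting point.\<close>

lemma fdiff_bound_mult:
  assumes "fdiff_bound K \<rho> I f b" "fdiff_bound K \<rho> I g c" "\<rho> > 0"
  shows "fdiff_bound K \<rho> I (\<lambda>i s. f i s * g i s) (b * c)"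
proof -
  obtain \<alpha> where a: "\<And>k. 0 \<le> \<alpha> k" "\<And>i. i \<in> I \<Longrightarrow> fdiff_majorant K \<rho> (f i) \<alpha>" "(\<Sum>k\<le>K. \<alpha> k) \<le> b"
    using fdiff_boundE[OF assms(1)] by metis
  obtain \<beta> where b: "\<And>k. 0 \<le> \<beta> k" "\<And>i. i \<in> I \<Longrightarrow> fdiff_majorant K \<rho> (g i) \<beta>" "(\<Sum>k\<le>K. \<beta> k) \<le> c"
    using fdiff_boundE[OF assms(2)] by metis
  show ?thesis
  proof (rule fdiff_boundI[where \<alpha> = "\<lambda>k. \<Sum>j\<le>k. \<alpha> j * \<beta> (k - j)"])
    fix i assume i: "i \<in> I"
    show "fdiff_majorant K \<rho> (\<lambda>s. f i s * g i s) (\<lambda>k. \<Sum>j\<le>k. \<alpha> j * \<beta> (k - j))"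
      unfolding fdiff_majorant_def
    proof (intro allI impI)
      fix k s assume sk: "s + k \<le> K"
      have "\<bar>(fdiff ^^ k) (\<lambda>s. f i s * g i s) s\<bar> * \<rho> ^ k / fact k \<le>
        (\<Sum>j\<le>k. \<bar>real (k choose j) * (fdiff ^^ j) (f i) s * (fdiff ^^ (k - j)) (g i) (s + j)\<bar>)
          * \<rho> ^ k / fact k"
        unfolding fdiff_pow_mult using assms(3) by (intro divide_right_mono mult_right_mono) auto
      also have "\<dots> = (\<Sum>j\<le>k. (\<bar>(fdiff ^^ j) (f i) s\<bar> * \<rho> ^ j / fact j) *
          (\<bar>(fdiff ^^ (k - j)) (g i) (s + j)\<bar> * \<rho> ^ (k - j) / fact (k - j)))"
        unfolding sum_distrib_right sum_divide_distrib
      proof (intro sum.cong refl)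
        fix j assume "j \<in> {..k}"
        then have j: "j \<le> k" by simp
        have "\<rho> ^ k = \<rho> ^ j * \<rho> ^ (k - j)"
          using j by (simp flip: power_add)
        then show "\<bar>real (k choose j) * (fdiff ^^ j) (f i) s * (fdiff ^^ (k - j)) (g i) (s + j)\<bar> *
            \<rho> ^ k / fact k = (\<bar>(fdiff ^^ j) (f i) s\<bar> * \<rho> ^ j / fact j) *
          (\<bar>(fdiff ^^ (k - j)) (g i) (s + j)\<bar> * \<rho> ^ (k - j) / fact (k - j))"
          by (simp add: binomial_fact[OF j] abs_mult)
      qed
      also have "\<dots> \<le> (\<Sum>j\<le>k. \<alpha> j * \<beta> (k - j))"
      proof (intro sum_mono mult_mono)
        fix j assume "j \<in> {..k}"
        then have "s + j \<le> K" "s + j + (k - j) \<le> K" using sk by auto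
        then show "\<bar>(fdiff ^^ j) (f i) s\<bar> * \<rho> ^ j / fact j \<le> \<alpha> j"
          "\<bar>(fdiff ^^ (k - j)) (g i) (s + j)\<bar> * \<rho> ^ (k - j) / fact (k - j) \<le> \<beta> (k - j)"
          using a(2)[OF i] b(2)[OF i] unfolding fdiff_majorant_def by blast+
      qed (use a(1) assms(3) in auto)
      finally show "\<bar>(fdiff ^^ k) (\<lambda>s. f i s * g i s) s\<bar> * \<rho> ^ k / fact k \<le>
          (\<Sum>j\<le>k. \<alpha> j * \<beta> (k - j))" .
    qed
  next
    have "(\<Sum>k\<le>K. \<Sum>j\<le>k. \<alpha> j * \<beta> (k - j)) \<le> (\<Sum>k\<le>K. \<alpha> k) * (\<Sum>k\<le>K. \<beta> k)"
      by (rule sum_convolution_le) (use a b in auto)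
    also have "\<dots> \<le> b * c"
      using a b by (intro mult_mono) (auto intro!: sum_nonneg intro: order_trans[OF sum_nonneg])
    finally show "(\<Sum>k\<le>K. \<Sum>j\<le>k. \<alpha> j * \<beta> (k - j)) \<le> b * c" .
  qed (use a b in \<open>auto intro: sum_nonneg\<close>)
qed

lemma fdiff_bound_cmult:
  assumes "fdiff_bound K \<rho> I f b" "\<rho> > 0"
  shows "fdiff_bound K \<rho> I (\<lambda>i s. r * f i s) (\<bar>r\<bar> * b)"
  by (rule fdiff_bound_mult[OF fdiff_bound_const assms]) simp

lemma fdiff_bound_diff:
  assumes "fdiff_bound K \<rho> I f b" "fdiff_bound K \<rho> I g c" "\<rho> > 0"
  shows "fdiff_bound K \<rho> I (\<lambda>i s. f i s - g i s) (b + c)"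
  using fdiff_bound_add[OF assms(1) fdiff_bound_cmult[OF assms(2,3), of "-1"] assms(3)] by simp

section \<open>Power series in the window norm\<close>

lemma fdiff_bound_power:
  assumes "fdiff_bound K \<rho> I f b" "\<rho> > 0"
  shows "fdiff_bound K \<rho> I (\<lambda>i s. f i s ^ m) (b ^ m)"
proof (induction m)
  case 0
  show ?case using fdiff_bound_const[of I "\<lambda>i s. 1" 1 K \<rho>] by simp
next
  case (Suc m)
  show ?case using fdiff_bound_mult[OF assms(1) Suc assms(2)] by simp
qed

text \<open>Completeness of the algebra: the majorants of the terms are added up order by order,
  each dominated by the summable \<open>c\<close>.\<close>

lemma fdiff_bound_suminf:
  assumes "\<And>m. fdiff_bound K \<rho> I (f m) (c m)" "c sums c'" "\<rho> > 0"
    "\<And>i s. i \<in> I \<Longrightarrow> s \<le> K \<Longrightarrow> (\<lambda>m. f m i s) sums g i s"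
  shows "fdiff_bound K \<rho> I g c'"
proof -
  have "\<forall>m. \<exists>\<alpha>. (\<forall>k. 0 \<le> \<alpha> k) \<and> (\<forall>i\<in>I. fdiff_majorant K \<rho> (f m i) \<alpha>) \<and> (\<Sum>k\<le>K. \<alpha> k) \<le> c m"
    using assms(1) unfolding fdiff_bound_def by blast
  then obtain A where A: "\<And>m k. 0 \<le> A m k" "\<And>m i. i \<in> I \<Longrightarrow> fdiff_majorant K \<rho> (f m i) (A m)"
      "\<And>m. (\<Sum>k\<le>K. A m k) \<le> c m"
    by metis
  have sA: "summable (\<lambda>m. A m k)" if "k \<le> K" for k
  proof (rule summable_comparison_test')
    show "summable c" using assms(2) by (rule sums_summable)
    fix m :: nat
    have "A m k \<le> (\<Sum>k\<le>K. A m k)"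
      by (rule member_le_sum) (use A(1) that in auto)
    with A(1,3) show "norm (A m k) \<le> c m"
      by (simp add: order_trans)
  qed
  show ?thesis
  \<comment> \<open>Orders above \<open>K\<close> get the value 0, since \<open>A m k\<close> is
    known to be summable in \<open>m\<close> only for \<open>k \<le> K\<close>.\<close>
  proof (rule fdiff_boundI[where \<alpha> = "\<lambda>k. if k \<le> K then \<Sum>m. A m k else 0"])
    show "0 \<le> (if k \<le> K then \<Sum>m. A m k else 0)" for k
      using A(1) sA by (auto intro!: suminf_nonneg)
    fix i assume i: "i \<in> I"
    show "fdiff_majorant K \<rho> (g i) (\<lambda>k. if k \<le> K then \<Sum>m. A m k else 0)"
      unfolding fdiff_majorant_def
    proof (intro allI impI)
      fix k s assume sk: "s + k \<le> K"
      then have k: "k \<le> K" by simp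
      have d: "(\<lambda>m. (fdiff ^^ k) (f m i) s) sums (fdiff ^^ k) (g i) s"
        by (rule fdiff_pow_sums) (use assms(4)[OF i] sk in auto)
      have le: "\<bar>(fdiff ^^ k) (f m i) s\<bar> \<le> A m k * (fact k / \<rho> ^ k)" for m
      proof -
        have "\<bar>(fdiff ^^ k) (f m i) s\<bar> * \<rho> ^ k / fact k \<le> A m k"
          using A(2)[OF i, of m] sk unfolding fdiff_majorant_def by blast
        then show ?thesis using assms(3) by (simp add: field_simps)
      qed
      have "\<bar>(fdiff ^^ k) (g i) s\<bar> \<le> (\<Sum>m. A m k * (fact k / \<rho> ^ k))"
        using norm_suminf_le[of "\<lambda>m. (fdiff ^^ k) (f m i) s" "\<lambda>m. A m k * (fact k / \<rho> ^ k)"]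
          le summable_mult2[OF sA[OF k]] sums_unique[OF d] by auto
      also have "\<dots> = (\<Sum>m. A m k) * (fact k / \<rho> ^ k)"
        by (rule suminf_mult2[symmetric]) (rule sA[OF k])
      finally show "\<bar>(fdiff ^^ k) (g i) s\<bar> * \<rho> ^ k / fact k \<le> (if k \<le> K then \<Sum>m. A m k else 0)"
        using assms(3) k by (simp add: field_simps)
    qed
  next
    have "(\<Sum>k\<le>K. if k \<le> K then \<Sum>m. A m k else 0) = (\<Sum>k\<le>K. \<Sum>m. A m k)"
      by (rule sum.cong) auto
    also have "\<dots> = (\<Sum>m. \<Sum>k\<le>K. A m k)"
      by (rule suminf_sum[symmetric]) (use sA in auto)
    also have "\<dots> \<le> (\<Sum>m. c m)"
      by (rule suminf_le[OF A(3)]) (use sA sums_summable[OF assms(2)] in \<open>auto intro: summable_sum\<close>)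
    finally show "(\<Sum>k\<le>K. if k \<le> K then \<Sum>m. A m k else 0) \<le> c'"
      using sums_unique[OF assms(2)] by simp
  qed
qed

text \<open>The series of \<open>exp\<close> without its constant term gives the bound
  \<open>exp b - 1\<close>. Subtracting 1 keeps the result proportional to \<open>b\<close>, which
  matters for the later smallness conditions.\<close>

lemma fdiff_bound_exp:
  assumes "fdiff_bound K \<rho> I f b" "\<rho> > 0" "b \<le> 1 / 2"
  shows "fdiff_bound K \<rho> I (\<lambda>i s. exp (f i s) - 1) (2 * b)"
proof (rule fdiff_bound_mono)
  let ?c = "\<lambda>m. \<bar>1 / fact (Suc m)\<bar> * b ^ Suc m :: real"
  have ser: "(\<lambda>m. (1 / fact (Suc m)) * x ^ Suc m) sums (exp x - 1)" for x :: real
    using sums_Suc_iff[of "\<lambda>m. (1 / fact m) * x ^ m" "exp x - 1"] exp_converges[of x]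
    by (simp add: divide_simps)
  show "fdiff_bound K \<rho> I (\<lambda>i s. exp (f i s) - 1) (exp b - 1)"
  proof (rule fdiff_bound_suminf[where f = "\<lambda>m i s. (1 / fact (Suc m)) * f i s ^ Suc m"])
    show "fdiff_bound K \<rho> I (\<lambda>i s. (1 / fact (Suc m)) * f i s ^ Suc m) (?c m)" for m
      by (intro fdiff_bound_cmult fdiff_bound_power assms)
    show "?c sums (exp b - 1)"
      using ser[of b] by (simp add: abs_mult)
    show "(\<lambda>m. (1 / fact (Suc m)) * f i s ^ Suc m) sums (exp (f i s) - 1)" for i s
      by (rule ser)
  qed (rule assms)
  have "0 \<le> b" by (rule fdiff_bound_nonneg[OF assms(1)])
  then have "exp b \<le> 1 + b + b\<^sup>2"
    using assms(3) by (intro exp_bound) auto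
  also have "b\<^sup>2 \<le> b * 1"
    unfolding power2_eq_square using \<open>0 \<le> b\<close> assms(3) by (intro mult_left_mono) auto
  finally show "exp b - 1 \<le> 2 * b" by simp
qed

text \<open>A Neumann series in \<open>1 - f\<close>, with geometric bound
  \<open>1 / (1 - b) \<le> 2\<close>.\<close>

lemma fdiff_bound_inverse:
  assumes "fdiff_bound K \<rho> I (\<lambda>i s. f i s - 1) b" "\<rho> > 0" "b \<le> 1 / 2"
  shows "fdiff_bound K \<rho> I (\<lambda>i s. 1 / f i s) 2"
proof (rule fdiff_bound_mono)
  have b: "0 \<le> b" by (rule fdiff_bound_nonneg[OF assms(1)])
  have 1: "fdiff_bound K \<rho> I (\<lambda>i s. 1 - f i s) b"
    using fdiff_bound_cmult[OF assms(1,2), of "-1"] by simp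
  show "fdiff_bound K \<rho> I (\<lambda>i s. 1 / f i s) (1 / (1 - b))"
  proof (rule fdiff_bound_suminf[where f = "\<lambda>m i s. (1 - f i s) ^ m"])
    show "fdiff_bound K \<rho> I (\<lambda>i s. (1 - f i s) ^ m) (b ^ m)" for m
      by (intro fdiff_bound_power 1 assms)
    show "(\<lambda>m. b ^ m) sums (1 / (1 - b))"
      by (rule geometric_sums) (use b assms(3) in auto)
    show "(\<lambda>m. (1 - f i s) ^ m) sums (1 / f i s)" if "i \<in> I" "s \<le> K" for i s
    proof -
      \<comment> \<open>The norm at order 0 is a pointwise bound, which makes the geometric series
        converge at every point of the window.\<close>
      have "\<bar>1 - f i s\<bar> \<le> b"
        using fdiff_bound_le[OF 1 that(1), of s 0] that(2) assms(2) by simp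
      then show ?thesis
        using geometric_sums[of "1 - f i s"] assms(3) by simp
    qed
  qed (rule assms)
  show "1 / (1 - b) \<le> 2" using assms(3) by (simp add: field_simps)
qed

text \<open>The window grows by one without any loss in the radius \<open>\<rho>\<close>.\<close>

lemma fdiff_bound_step:
  assumes "fdiff_bound K \<rho> I (\<lambda>i. fdiff (f i)) c" "\<rho> > 0" "0 \<le> b"
    "\<And>i s. i \<in> I \<Longrightarrow> s \<le> Suc K \<Longrightarrow> \<bar>f i s\<bar> \<le> b"
  shows "fdiff_bound (Suc K) \<rho> I f (b + \<rho> * c)"
proof -
  obtain \<alpha> where a: "\<And>k. 0 \<le> \<alpha> k" "\<And>i. i \<in> I \<Longrightarrow> fdiff_majorant K \<rho> (fdiff (f i)) \<alpha>" "(\<Sum>k\<le>K. \<alpha> k) \<le> c"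
    using fdiff_boundE[OF assms(1)] by metis
  let ?\<alpha> = "\<lambda>k. case k of 0 \<Rightarrow> b | Suc k \<Rightarrow> \<rho> * \<alpha> k"
  show ?thesis
  proof (rule fdiff_boundI[where \<alpha> = ?\<alpha>])
    show "0 \<le> ?\<alpha> k" for k
      using a(1) assms by (cases k) auto
    fix i assume i: "i \<in> I"
    show "fdiff_majorant (Suc K) \<rho> (f i) ?\<alpha>"
      unfolding fdiff_majorant_def
    proof (intro allI impI)
      fix k s assume sk: "s + k \<le> Suc K"
      show "\<bar>(fdiff ^^ k) (f i) s\<bar> * \<rho> ^ k / fact k \<le> ?\<alpha> k"
      proof (cases k)
        case 0
        then show ?thesis using assms(4)[OF i] sk by simp
      next
        case (Suc l)
        define D where "D = \<bar>(fdiff ^^ l) (fdiff (f i)) s\<bar> * \<rho> ^ l / fact l"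
        have D: "D \<le> \<alpha> l"
          unfolding D_def using a(2)[OF i] sk Suc unfolding fdiff_majorant_def by simp
        have "\<bar>(fdiff ^^ k) (f i) s\<bar> * \<rho> ^ k / fact k = \<rho> * (D / real (Suc l))"
          unfolding Suc fdiff_pow_Suc' D_def by (simp add: mult_ac)
        \<comment> \<open>The gain \<open>1 / Suc l\<close> from passing between the factorials is
          given away.\<close>
        also have "\<dots> \<le> \<rho> * (D / 1)"
          using assms(2) by (intro mult_left_mono divide_left_mono) (auto simp: D_def)
        also have "\<dots> \<le> \<rho> * \<alpha> l"
          using D assms(2) by simp
        finally show ?thesis using Suc by simp
      qed
    qed
  next
    have "(\<Sum>k\<le>Suc K. ?\<alpha> k) = b + \<rho> * (\<Sum>k\<le>K. \<alpha> k)"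
      by (subst sum.atMost_Suc_shift) (simp add: sum_distrib_left)
    also have "\<dots> \<le> b + \<rho> * c" using a(3) assms(2) by simp
    finally show "(\<Sum>k\<le>Suc K. ?\<alpha> k) \<le> b + \<rho> * c" .
  qed
qed

text \<open>Differences are linear and the weights form a convex combination, so a majorant common
  to all \<open>(j, a)\<close> survives unchanged, whatever the number of actions.\<close>

lemma fdiff_bound_average:
  assumes "fdiff_bound K \<rho> (SIGMA j:J. A j) f b" "\<rho> > 0"
    "\<And>j a. j \<in> J \<Longrightarrow> a \<in> A j \<Longrightarrow> 0 \<le> w j a" "\<And>j. j \<in> J \<Longrightarrow> (\<Sum>a\<in>A j. w j a) = 1"
  shows "fdiff_bound K \<rho> J (\<lambda>j s. \<Sum>a\<in>A j. w j a * f (j, a) s) b"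
proof -
  obtain \<alpha> where a: "\<And>k. 0 \<le> \<alpha> k" "\<And>i. i \<in> (SIGMA j:J. A j) \<Longrightarrow> fdiff_majorant K \<rho> (f i) \<alpha>"
      "(\<Sum>k\<le>K. \<alpha> k) \<le> b"
    using fdiff_boundE[OF assms(1)] by metis
  show ?thesis
  proof (rule fdiff_boundI[OF a(1) _ a(3)])
    fix j assume j: "j \<in> J"
    show "fdiff_majorant K \<rho> (\<lambda>s. \<Sum>a\<in>A j. w j a * f (j, a) s) \<alpha>"
      unfolding fdiff_majorant_def
    proof (intro allI impI)
      fix k s assume sk: "s + k \<le> K"
      have "\<bar>(fdiff ^^ k) (\<lambda>s. \<Sum>a\<in>A j. w j a * f (j, a) s) s\<bar> * \<rho> ^ k / fact k \<le>
          (\<Sum>a\<in>A j. \<bar>w j a * (fdiff ^^ k) (f (j, a)) s\<bar>) * \<rho> ^ k / fact k"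
        unfolding fdiff_pow_sum using assms(2) by (intro divide_right_mono mult_right_mono) auto
      also have "\<dots> = (\<Sum>a\<in>A j. w j a * (\<bar>(fdiff ^^ k) (f (j, a)) s\<bar> * \<rho> ^ k / fact k))"
        unfolding sum_distrib_right sum_divide_distrib
        using assms(3)[OF j] by (intro sum.cong) (auto simp: abs_mult mult_ac)
      also have "\<dots> \<le> (\<Sum>a\<in>A j. w j a * \<alpha> k)"
      proof (intro sum_mono mult_left_mono)
        fix x assume "x \<in> A j"
        then show "\<bar>(fdiff ^^ k) (f (j, x)) s\<bar> * \<rho> ^ k / fact k \<le> \<alpha> k"
          using a(2)[of "(j, x)"] j sk unfolding fdiff_majorant_def by blast
      qed (use assms(3)[OF j] in auto)
      also have "\<dots> = \<alpha> k"
        using assms(4)[OF j] by (simp flip: sum_distrib_right)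
      finally show "\<bar>(fdiff ^^ k) (\<lambda>s. \<Sum>a\<in>A j. w j a * f (j, a) s) s\<bar> * \<rho> ^ k / fact k \<le> \<alpha> k" .
    qed
  qed
qed

section \<open>Expectations under product distributions\<close>

text \<open>Induction on \<open>m\<close>, splitting off one chosen factor from each set. Because
  one majorant serves all \<open>S\<close> of size \<open>m\<close> and all \<open>p\<close>, the
  second moments below can be bounded by the size of \<open>S\<close> alone.\<close>

lemma fdiff_bound_prod_subsets:
  fixes f :: "'j \<times> 'a \<Rightarrow> nat \<Rightarrow> real"
  assumes "fdiff_bound K \<rho> (SIGMA j:J. A j) f c" "finite J" "\<rho> > 0"
  shows "fdiff_bound K \<rho> {(S, p). S \<subseteq> J \<and> card S = m \<and> (\<forall>j\<in>S. p j \<in> A j)}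
           (\<lambda>(S, p) s. \<Prod>j\<in>S. f (j, p j) s) (c ^ m)"
proof (induction m)
  case 0
  have *: "(case i of (S, p) \<Rightarrow> \<lambda>s. \<Prod>j\<in>S. f (j, p j) s) s = 1"
    if "i \<in> {(S, p). S \<subseteq> J \<and> card S = 0 \<and> (\<forall>j\<in>S. p j \<in> A j)}" for i s
    using that assms(2) by (auto simp: finite_subset)
  show ?case
    using fdiff_bound_const[OF *, where K = K and \<rho> = \<rho>] by (simp only: abs_one power_0)
next
  case (Suc m)
  let ?I = "\<lambda>m. {(S, p). S \<subseteq> J \<and> card S = m \<and> (\<forall>j\<in>S. p j \<in> A j)}"
  define e where "e = (\<lambda>S :: 'j set. SOME j. j \<in> S)"
  have e: "e S \<in> S" if "(S, p) \<in> ?I (Suc m)" for S p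
  proof -
    have "S \<noteq> {}" using that by auto
    then show ?thesis unfolding e_def by (simp add: some_in_eq)
  qed
  have 1: "fdiff_bound K \<rho> (?I (Suc m)) (\<lambda>(S, p) s. \<Prod>j\<in>S - {e S}. f (j, p j) s) (c ^ m)"
  proof (rule fdiff_bound_reindex[OF Suc])
    fix i assume "i \<in> ?I (Suc m)"
    then show "(\<lambda>(S, p). (S - {e S}, p)) i \<in> ?I m"
      using e by (auto simp: card_Diff_singleton)
  qed auto
  have 2: "fdiff_bound K \<rho> (?I (Suc m)) (\<lambda>(S, p) s. f (e S, p (e S)) s) c"
  proof (rule fdiff_bound_reindex[OF assms(1)])
    fix i assume "i \<in> ?I (Suc m)"
    then obtain S p where Sp: "i = (S, p)" "(S, p) \<in> ?I (Suc m)" by (cases i) auto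
    then show "(\<lambda>(S, p). (e S, p (e S))) i \<in> (SIGMA j:J. A j)"
      using e[OF Sp(2)] by auto
  qed auto
  show ?case
    unfolding power_Suc
  proof (rule fdiff_bound_reindex[OF fdiff_bound_mult[OF 2 1 assms(3)]])
    fix i s assume "i \<in> ?I (Suc m)"
    then obtain S p where Sp: "i = (S, p)" "(S, p) \<in> ?I (Suc m)" by (cases i) auto
    then have "finite S" using finite_subset[OF _ assms(2)] by auto
    then show "(case i of (S, p) \<Rightarrow> \<lambda>s. \<Prod>j\<in>S. f (j, p j) s) s =
        (case i of (S, p) \<Rightarrow> \<lambda>s. f (e S, p (e S)) s) s *
        (case i of (S, p) \<Rightarrow> \<lambda>s. \<Prod>j\<in>S - {e S}. f (j, p j) s) s"
      using prod.remove[OF _ e[OF Sp(2)], of "\<lambda>j. f (j, p j) s"] by (simp add: Sp(1))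
  qed
qed

section \<open>Orthogonal expansion under a product distribution\<close>

context
  fixes J :: "'j set" and A :: "'j \<Rightarrow> 'a set" and w :: "'j \<Rightarrow> 'a \<Rightarrow> real"
    and f :: "'j \<times> 'a \<Rightarrow> nat \<Rightarrow> real"
  assumes finite_J: "finite J" and finite_A: "\<And>j. j \<in> J \<Longrightarrow> finite (A j)"
    and w_nonneg: "\<And>j a. j \<in> J \<Longrightarrow> a \<in> A j \<Longrightarrow> 0 \<le> w j a"
    and w_sum: "\<And>j. j \<in> J \<Longrightarrow> (\<Sum>a\<in>A j. w j a) = 1"
    and f_mean: "\<And>j s. j \<in> J \<Longrightarrow> (\<Sum>a\<in>A j. w j a * f (j, a) s) = 0"
begin

lemma product_weights_sum: "(\<Sum>p\<in>PiE J A. \<Prod>j\<in>J. w j (p j)) = 1"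
  using prod_sum_PiE[of J A w] finite_J finite_A w_sum by simp

lemma product_weights_nonneg: "p \<in> PiE J A \<Longrightarrow> 0 \<le> (\<Prod>j\<in>J. w j (p j))"
  by (intro prod_nonneg) (auto intro: w_nonneg)

text \<open>The sum factorises over \<open>J\<close>, and a \<open>j\<close> lying in exactly one of
  \<open>S\<close> and \<open>T\<close> contributes its mean, which is zero. The two times
  \<open>s\<close> and \<open>t\<close> are independent so that each factor can be differenced
  separately.\<close>

lemma mean_zero_products_orthogonal:
  assumes "S \<subseteq> J" "T \<subseteq> J" "S \<noteq> T"
  shows "(\<Sum>p\<in>PiE J A. (\<Prod>j\<in>J. w j (p j)) * (\<Prod>j\<in>S. f (j, p j) s) * (\<Prod>j\<in>T. f (j, p j) t)) = 0"
proof -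
  let ?g = "\<lambda>j a. w j a * (if j \<in> S then f (j, a) s else 1) * (if j \<in> T then f (j, a) t else 1)"
  have restrict: "(\<Prod>j\<in>U. h j) = (\<Prod>j\<in>J. if j \<in> U then h j else 1)" if "U \<subseteq> J" for U and h :: "'j \<Rightarrow> real"
    using prod.inter_restrict[OF finite_J, of h U] that by (simp add: Int_absorb1)
  have "(\<Sum>p\<in>PiE J A. (\<Prod>j\<in>J. w j (p j)) * (\<Prod>j\<in>S. f (j, p j) s) * (\<Prod>j\<in>T. f (j, p j) t)) =
      (\<Sum>p\<in>PiE J A. \<Prod>j\<in>J. ?g j (p j))"
    by (simp add: restrict[OF assms(1)] restrict[OF assms(2)] prod.distrib)
  also have "\<dots> = (\<Prod>j\<in>J. \<Sum>a\<in>A j. ?g j a)"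
    by (rule prod_sum_PiE[OF finite_J finite_A, symmetric])
  also have "\<dots> = 0"
  proof -
    obtain j where j: "j \<in> J" "j \<in> S \<longleftrightarrow> j \<notin> T" using assms by blast
    then have "(\<Sum>a\<in>A j. ?g j a) = 0"
      using f_mean[OF j(1)] by (cases "j \<in> S") auto
    then show ?thesis
      using j(1) finite_J by (auto intro: prod_zero)
  qed
  finally show ?thesis .
qed

lemma fdiff_mean_zero_products_orthogonal:
  assumes "S \<subseteq> J" "T \<subseteq> J" "S \<noteq> T"
  shows "(\<Sum>p\<in>PiE J A. (\<Prod>j\<in>J. w j (p j)) * (fdiff ^^ k) (\<lambda>s. \<Prod>j\<in>S. f (j, p j) s) s *
           (fdiff ^^ k) (\<lambda>s. \<Prod>j\<in>T. f (j, p j) s) s) = 0"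
proof -
  let ?w = "\<lambda>p. \<Prod>j\<in>J. w j (p j)" and ?F = "\<lambda>S p s. \<Prod>j\<in>S. f (j, p j) s"
  \<comment> \<open>First the difference is taken in the time of \<open>S\<close> with
    \<open>t\<close> frozen; afterwards in \<open>t\<close>.\<close>
  have 1: "(\<Sum>p\<in>PiE J A. (?w p * ?F T p t) * (fdiff ^^ k) (?F S p) s) = 0" for t
    unfolding fdiff_pow_sum[symmetric]
    using mean_zero_products_orthogonal[OF assms, of _ t]
    by (simp add: mult_ac fdiff_pow_zero)
  have "(\<Sum>p\<in>PiE J A. (?w p * (fdiff ^^ k) (?F S p) s) * (fdiff ^^ k) (?F T p) s) =
      (fdiff ^^ k) (\<lambda>t. \<Sum>p\<in>PiE J A. (?w p * (fdiff ^^ k) (?F S p) s) * ?F T p t) s"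
    by (rule fdiff_pow_sum[symmetric])
  also have "(\<lambda>t. \<Sum>p\<in>PiE J A. (?w p * (fdiff ^^ k) (?F S p) s) * ?F T p t) = (\<lambda>t. 0)"
    using 1 by (simp add: mult_ac)
  finally show ?thesis by (simp add: fdiff_pow_zero)
qed

text \<open>Pythagoras: the product is expanded over subsets of \<open>J\<close> and all cross terms
  vanish by orthogonality.\<close>

lemma second_moment_fdiff_product:
  "(\<Sum>p\<in>PiE J A. (\<Prod>j\<in>J. w j (p j)) * ((fdiff ^^ k) (\<lambda>s. \<Prod>j\<in>J. f (j, p j) s + 1) s)\<^sup>2) =
   (\<Sum>S\<in>Pow J. \<Sum>p\<in>PiE J A. (\<Prod>j\<in>J. w j (p j)) * ((fdiff ^^ k) (\<lambda>s. \<Prod>j\<in>S. f (j, p j) s) s)\<^sup>2)"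
proof -
  let ?w = "\<lambda>p. \<Prod>j\<in>J. w j (p j)"
  let ?D = "\<lambda>S p. (fdiff ^^ k) (\<lambda>s. \<Prod>j\<in>S. f (j, p j) s) s"
  have "(fdiff ^^ k) (\<lambda>s. \<Prod>j\<in>J. f (j, p j) s + 1) s = (\<Sum>S\<in>Pow J. ?D S p)" for p
    using fdiff_pow_sum[of k "\<lambda>_. 1" "\<lambda>S s. \<Prod>j\<in>S. f (j, p j) s" "Pow J" s]
    by (simp add: prod_add[OF finite_J])
  then have "(\<Sum>p\<in>PiE J A. ?w p * ((fdiff ^^ k) (\<lambda>s. \<Prod>j\<in>J. f (j, p j) s + 1) s)\<^sup>2) =
      (\<Sum>p\<in>PiE J A. \<Sum>S\<in>Pow J. \<Sum>T\<in>Pow J. ?w p * ?D S p * ?D T p)"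
    by (simp add: power2_eq_square sum_product sum_distrib_left mult_ac)
  also have "\<dots> = (\<Sum>S\<in>Pow J. \<Sum>T\<in>Pow J. \<Sum>p\<in>PiE J A. ?w p * ?D S p * ?D T p)"
    by (subst sum.swap) (intro sum.cong refl sum.swap)
  also have "\<dots> = (\<Sum>S\<in>Pow J. \<Sum>p\<in>PiE J A. ?w p * ?D S p * ?D S p)"
  proof (intro sum.cong refl)
    fix S assume S: "S \<in> Pow J"
    have "(\<Sum>T\<in>Pow J. \<Sum>p\<in>PiE J A. ?w p * ?D S p * ?D T p) =
        (\<Sum>T\<in>Pow J. if T = S then \<Sum>p\<in>PiE J A. ?w p * ?D S p * ?D S p else 0)"
      by (rule sum.cong) (use S fdiff_mean_zero_products_orthogonal in auto)
    then show "(\<Sum>T\<in>Pow J. \<Sum>p\<in>PiE J A. ?w p * ?D S p * ?D T p) = (\<Sum>p\<in>PiE J A. ?w p * ?D S p * ?D S p)"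
      using S finite_J by simp
  qed
  finally show ?thesis by (simp add: power2_eq_square mult_ac)
qed

text \<open>Cauchy-Schwarz with respect to the product distribution removes the arbitrary bounded
  \<open>L\<close>, leaving a second moment to which Pythagoras applies. A triangle inequality over
  subsets would instead give the sum of the \<open>b (card S)\<close>.\<close>

lemma fdiff_expectation_le:
  assumes L: "\<And>p. p \<in> PiE J A \<Longrightarrow> \<bar>L p\<bar> \<le> 1"
    and D: "\<And>S p. S \<subseteq> J \<Longrightarrow> p \<in> PiE J A \<Longrightarrow> \<bar>(fdiff ^^ k) (\<lambda>s. \<Prod>j\<in>S. f (j, p j) s) s\<bar> \<le> b (card S)"
  shows "\<bar>(fdiff ^^ k) (\<lambda>s. \<Sum>p\<in>PiE J A. L p * (\<Prod>j\<in>J. w j (p j) * (f (j, p j) s + 1))) s\<bar> \<le>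
    sqrt (\<Sum>S\<in>Pow J. (b (card S))\<^sup>2)"
proof -
  let ?w = "\<lambda>p. \<Prod>j\<in>J. w j (p j)"
  define P where "P p = (fdiff ^^ k) (\<lambda>s. \<Prod>j\<in>J. f (j, p j) s + 1) s" for p
  define E where "E = (\<Sum>p\<in>PiE J A. L p * ?w p * P p)"
  have w0: "0 \<le> ?w p" if "p \<in> PiE J A" for p
    by (rule product_weights_nonneg[OF that])
  \<comment> \<open>The weight is split as a product of two square roots, one for each
    Cauchy-Schwarz factor.\<close>
  have "E\<^sup>2 = (\<Sum>p\<in>PiE J A. sqrt (?w p) * (sqrt (?w p) * (L p * P p)))\<^sup>2"
    unfolding E_def by (intro arg_cong[where f = "\<lambda>x. x\<^sup>2"] sum.cong refl) (auto simp: w0)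
  also have "\<dots> \<le> (\<Sum>p\<in>PiE J A. (sqrt (?w p))\<^sup>2) * (\<Sum>p\<in>PiE J A. (sqrt (?w p) * (L p * P p))\<^sup>2)"
    by (rule Cauchy_Schwarz_ineq_sum)
  also have "(\<Sum>p\<in>PiE J A. (sqrt (?w p))\<^sup>2) = 1"
    using w0 by (simp add: product_weights_sum)
  also have "1 * (\<Sum>p\<in>PiE J A. (sqrt (?w p) * (L p * P p))\<^sup>2) \<le> (\<Sum>p\<in>PiE J A. ?w p * (P p)\<^sup>2)"
    unfolding mult_1
  proof (rule sum_mono)
    fix p assume p: "p \<in> PiE J A"
    have "(L p * P p)\<^sup>2 \<le> 1 * (P p)\<^sup>2"
      unfolding power_mult_distrib using L[OF p] by (intro mult_right_mono) (auto simp: abs_square_le_1)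
    then show "(sqrt (?w p) * (L p * P p))\<^sup>2 \<le> ?w p * (P p)\<^sup>2"
      unfolding power_mult_distrib[of "sqrt (?w p)"] using w0[OF p] by (simp add: mult_left_mono)
  qed
  also have "\<dots> = (\<Sum>S\<in>Pow J. \<Sum>p\<in>PiE J A. ?w p * ((fdiff ^^ k) (\<lambda>s. \<Prod>j\<in>S. f (j, p j) s) s)\<^sup>2)"
    unfolding P_def by (rule second_moment_fdiff_product)
  also have "\<dots> \<le> (\<Sum>S\<in>Pow J. \<Sum>p\<in>PiE J A. ?w p * (b (card S))\<^sup>2)"
  proof (intro sum_mono mult_left_mono w0)
    fix S p assume S: "S \<in> Pow J" "p \<in> PiE J A"
    then have "\<bar>(fdiff ^^ k) (\<lambda>s. \<Prod>j\<in>S. f (j, p j) s) s\<bar> \<le> b (card S)"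
      by (intro D) auto
    then show "((fdiff ^^ k) (\<lambda>s. \<Prod>j\<in>S. f (j, p j) s) s)\<^sup>2 \<le> (b (card S))\<^sup>2"
      by (rule sqrt_le_D[OF order_trans[OF eq_refl[OF real_sqrt_abs]]])
  qed
  also have "\<dots> = (\<Sum>S\<in>Pow J. (b (card S))\<^sup>2)"
    by (simp add: product_weights_sum flip: sum_distrib_right)
  finally have "\<bar>E\<bar> \<le> sqrt (\<Sum>S\<in>Pow J. (b (card S))\<^sup>2)"
    using real_le_rsqrt[of "\<bar>E\<bar>"] by simp
  moreover have "(fdiff ^^ k) (\<lambda>s. \<Sum>p\<in>PiE J A. L p * (\<Prod>j\<in>J. w j (p j) * (f (j, p j) s + 1))) s = E"
    unfolding E_def P_def fdiff_pow_sum[symmetric] by (simp add: prod.distrib mult_ac)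
  ultimately show ?thesis by simp
qed

end

text \<open>Subsets are grouped by size, and at most \<open>N ^ m\<close> of them have size
  \<open>m\<close>; the square root halves this exponent. Passing from the Euclidean norm to the sum
  over \<open>m\<close> makes the bound additive, so that it can be summed over the orders of
  difference.\<close>

lemma sqrt_sum_Pow_card_le:
  assumes "finite J" "card J \<le> N" "\<And>m. 0 \<le> b m"
  shows "sqrt (\<Sum>S\<in>Pow J. (b (card S))\<^sup>2) \<le> (\<Sum>m\<le>N. sqrt (real N) ^ m * b m)"
proof -
  have "(\<Sum>S\<in>Pow J. (b (card S))\<^sup>2) = (\<Sum>m\<le>N. \<Sum>S | S \<in> Pow J \<and> card S = m. (b (card S))\<^sup>2)"
    by (rule sum.group[symmetric]) (use assms in \<open>auto intro: order_trans[OF card_mono]\<close>)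
  also have "\<dots> = (\<Sum>m\<le>N. real (card J choose m) * (b m)\<^sup>2)"
    using n_subsets[OF assms(1)] by (intro sum.cong refl) simp
  also have "\<dots> \<le> (\<Sum>m\<le>N. (sqrt (real N) ^ m * b m)\<^sup>2)"
  proof (rule sum_mono)
    fix m
    have "card J choose m \<le> N ^ m"
      using binomial_le_pow[of m "card J"] assms(2) power_mono[of "card J" N m]
      by (cases "m \<le> card J") (auto simp: binomial_eq_0)
    then have "real (card J choose m) \<le> (sqrt (real N) ^ m)\<^sup>2"
      by (metis of_nat_0_le_iff of_nat_le_iff of_nat_power power_commutes power_mult real_sqrt_pow2 mult.commute)
    then show "real (card J choose m) * (b m)\<^sup>2 \<le> (sqrt (real N) ^ m * b m)\<^sup>2"
      unfolding power_mult_distrib by (intro mult_right_mono) auto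
  qed
  finally have "sqrt (\<Sum>S\<in>Pow J. (b (card S))\<^sup>2) \<le> L2_set (\<lambda>m. sqrt (real N) ^ m * b m) {..N}"
    unfolding L2_set_def by (rule real_sqrt_le_mono)
  also have "\<dots> \<le> (\<Sum>m\<le>N. sqrt (real N) ^ m * b m)"
    by (rule L2_set_le_sum) (use assms in auto)
  finally show ?thesis .
qed

text \<open>\<open>\<Gamma>\<close> indexes several expectations, each over its own set
  \<open>H \<gamma>\<close>; in the application these are all players but one. Bounding by
  \<open>card J\<close> instead of \<open>card (H \<gamma>)\<close> gives one majorant for all of
  them.\<close>

lemma fdiff_bound_expectation:
  fixes J :: "'j set" and A :: "'j \<Rightarrow> 'a set" and f :: "'j \<times> 'a \<Rightarrow> nat \<Rightarrow> real"
  assumes "finite J" and "\<And>j. j \<in> J \<Longrightarrow> finite (A j)"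
    and "\<And>j a. j \<in> J \<Longrightarrow> a \<in> A j \<Longrightarrow> 0 \<le> w j a"
    and "\<And>j. j \<in> J \<Longrightarrow> (\<Sum>a\<in>A j. w j a) = 1"
    and "\<And>j s. j \<in> J \<Longrightarrow> (\<Sum>a\<in>A j. w j a * f (j, a) s) = 0"
    and f: "fdiff_bound K \<rho> (SIGMA j:J. A j) f c" "\<rho> > 0" "sqrt (card J) * c \<le> 1 / 2"
    and H: "\<And>\<gamma>. \<gamma> \<in> \<Gamma> \<Longrightarrow> H \<gamma> \<subseteq> J"
    and L: "\<And>\<gamma> p. \<gamma> \<in> \<Gamma> \<Longrightarrow> p \<in> PiE (H \<gamma>) A \<Longrightarrow> \<bar>L \<gamma> p\<bar> \<le> 1"
  shows "fdiff_bound K \<rho> \<Gamma>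
    (\<lambda>\<gamma> s. \<Sum>p\<in>PiE (H \<gamma>) A. L \<gamma> p * (\<Prod>j\<in>H \<gamma>. w j (p j) * (f (j, p j) s + 1))) 2"
proof -
  let ?I = "\<lambda>m. {(S, p). S \<subseteq> J \<and> card S = m \<and> (\<forall>j\<in>S. p j \<in> A j)}"
  let ?N = "card J"
  have "\<forall>m. \<exists>\<alpha>. (\<forall>k. 0 \<le> \<alpha> k) \<and>
      (\<forall>i\<in>?I m. fdiff_majorant K \<rho> ((\<lambda>(S, p) s. \<Prod>j\<in>S. f (j, p j) s) i) \<alpha>) \<and> (\<Sum>k\<le>K. \<alpha> k) \<le> c ^ m"
    using fdiff_bound_prod_subsets[OF f(1) assms(1) f(2)] unfolding fdiff_bound_def by blast
  from choice[OF this] obtain \<alpha> where \<alpha>: "\<forall>m. (\<forall>k. 0 \<le> \<alpha> m k) \<and>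
      (\<forall>i\<in>?I m. fdiff_majorant K \<rho> ((\<lambda>(S, p) s. \<Prod>j\<in>S. f (j, p j) s) i) (\<alpha> m)) \<and> (\<Sum>k\<le>K. \<alpha> m k) \<le> c ^ m"
    by (rule exE)
  have a: "0 \<le> \<alpha> m k" "(\<Sum>k\<le>K. \<alpha> m k) \<le> c ^ m" for m k
    using \<alpha> by blast+
  have a2: "fdiff_majorant K \<rho> (\<lambda>s. \<Prod>j\<in>S. f (j, p j) s) (\<alpha> (card S))"
    if "S \<subseteq> J" "\<And>j. j \<in> S \<Longrightarrow> p j \<in> A j" for S p
    using \<alpha>[rule_format, of "card S"] that by fastforce
  show ?thesis
  proof (rule fdiff_boundI[where \<alpha> = "\<lambda>k. \<Sum>m\<le>?N. sqrt (real ?N) ^ m * \<alpha> m k"])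
    show "0 \<le> (\<Sum>m\<le>?N. sqrt (real ?N) ^ m * \<alpha> m k)" for k
      using a(1) by (auto intro!: sum_nonneg)
  next
    fix \<gamma> assume \<gamma>: "\<gamma> \<in> \<Gamma>"
    have HJ: "H \<gamma> \<subseteq> J" by (rule H[OF \<gamma>])
    show "fdiff_majorant K \<rho>
        (\<lambda>s. \<Sum>p\<in>PiE (H \<gamma>) A. L \<gamma> p * (\<Prod>j\<in>H \<gamma>. w j (p j) * (f (j, p j) s + 1)))
        (\<lambda>k. \<Sum>m\<le>?N. sqrt (real ?N) ^ m * \<alpha> m k)"
      unfolding fdiff_majorant_def
    proof (intro allI impI)
      fix k s assume sk: "s + k \<le> K"
      \<comment> \<open>\<open>q\<close> undoes the normalisation, since the expectation bound
        concerns unscaled differences.\<close>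
      define q where "q = fact k / \<rho> ^ k"
      have q: "q > 0" using f(2) by (simp add: q_def)
      have "\<bar>(fdiff ^^ k) (\<lambda>s. \<Sum>p\<in>PiE (H \<gamma>) A. L \<gamma> p * (\<Prod>j\<in>H \<gamma>. w j (p j) * (f (j, p j) s + 1))) s\<bar>
          \<le> sqrt (\<Sum>S\<in>Pow (H \<gamma>). (\<alpha> (card S) k * q)\<^sup>2)"
      proof (rule fdiff_expectation_le)
        fix S p assume S: "S \<subseteq> H \<gamma>" and p: "p \<in> PiE (H \<gamma>) A"
        then have "fdiff_majorant K \<rho> (\<lambda>s. \<Prod>j\<in>S. f (j, p j) s) (\<alpha> (card S))"
          using HJ by (intro a2) auto
        then have "\<bar>(fdiff ^^ k) (\<lambda>s. \<Prod>j\<in>S. f (j, p j) s) s\<bar> * \<rho> ^ k / fact k \<le> \<alpha> (card S) k"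
          using sk unfolding fdiff_majorant_def by simp
        then show "\<bar>(fdiff ^^ k) (\<lambda>s. \<Prod>j\<in>S. f (j, p j) s) s\<bar> \<le> \<alpha> (card S) k * q"
          using f(2) by (simp add: field_simps q_def)
      qed (use assms HJ L[OF \<gamma>] in \<open>auto intro: finite_subset\<close>)
      also have "\<dots> \<le> (\<Sum>m\<le>?N. sqrt (real ?N) ^ m * (\<alpha> m k * q))"
        by (rule sqrt_sum_Pow_card_le)
          (use a(1) q assms(1) HJ in \<open>auto intro: finite_subset card_mono\<close>)
      also have "\<dots> = (\<Sum>m\<le>?N. sqrt (real ?N) ^ m * \<alpha> m k) * q"
        by (simp add: sum_distrib_left mult_ac)
      finally show "\<bar>(fdiff ^^ k)
          (\<lambda>s. \<Sum>p\<in>PiE (H \<gamma>) A. L \<gamma> p * (\<Prod>j\<in>H \<gamma>. w j (p j) * (f (j, p j) s + 1))) s\<bar> * \<rho> ^ k / fact k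
        \<le> (\<Sum>m\<le>?N. sqrt (real ?N) ^ m * \<alpha> m k)"
        using f(2) by (simp add: field_simps q_def)
    qed
  next
    have c: "0 \<le> c" by (rule fdiff_bound_nonneg[OF f(1)])
    have "(\<Sum>k\<le>K. \<Sum>m\<le>?N. sqrt (real ?N) ^ m * \<alpha> m k) =
        (\<Sum>m\<le>?N. sqrt (real ?N) ^ m * (\<Sum>k\<le>K. \<alpha> m k))"
      by (subst sum.swap) (simp add: sum_distrib_left)
    also have "\<dots> \<le> (\<Sum>m\<le>?N. sqrt (real ?N) ^ m * c ^ m)"
      by (intro sum_mono mult_left_mono a(2)) auto
    \<comment> \<open>Only here is \<open>sqrt (card J) * c \<le> 1 / 2\<close> used; the geometric
      series explains the final constant 2.\<close>
    also have "\<dots> \<le> (\<Sum>m\<le>?N. (1 / 2) ^ m)"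
      unfolding power_mult_distrib[symmetric] using f(3) c by (intro sum_mono power_mono) auto
    also have "\<dots> \<le> (\<Sum>m. (1 / 2) ^ m)"
      by (rule sum_le_suminf) auto
    also have "\<dots> = (2 :: real)"
      by (simp add: suminf_geometric)
    finally show "(\<Sum>k\<le>K. \<Sum>m\<le>?N. sqrt (real ?N) ^ m * \<alpha> m k) \<le> 2" .
  qed
qed

section \<open>Optimistic Hedge\<close>

locale optimistic_hedge =
  fixes n :: nat and d :: "nat \<Rightarrow> nat" and L :: "nat \<Rightarrow> (nat \<Rightarrow> nat) \<Rightarrow> real" and \<eta> :: real
  assumes game: "is_game n d L" and eta_pos: "\<eta> > 0"
begin

abbreviation x :: "nat \<Rightarrow> nat \<Rightarrow> nat \<Rightarrow> real" where
  "x \<equiv> oh_strategy n d L \<eta>"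

abbreviation l :: "nat \<Rightarrow> nat \<Rightarrow> nat \<Rightarrow> real" where
  "l \<equiv> oh_loss n d L \<eta>"

abbreviation actions :: "(nat \<times> nat) set" where
  "actions \<equiv> SIGMA j:{1..n}. {1..d j}"

section \<open>Elementary properties of strategies and losses\<close>

lemma n_pos: "n \<ge> 1"
  using game by (simp add: is_game_def)

lemma d_pos: "j \<in> {1..n} \<Longrightarrow> d j \<ge> 1"
  using game by (simp add: is_game_def)

definition u :: "nat \<Rightarrow> nat \<Rightarrow> nat \<Rightarrow> real" where
  "u t j a = - \<eta> * (2 * l t j a - l (t - 1) j a)"

lemma x_Suc:
  assumes "t \<ge> 1"
  shows "x (Suc t) j a = x t j a * exp (u t j a) / (\<Sum>b\<in>{1..d j}. x t j b * exp (u t j b))"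
proof -
  obtain t' where "t = Suc t'" using assms by (cases t) auto
  then show ?thesis by (simp add: u_def)
qed

lemma x_pos:
  assumes "t \<ge> 1" "j \<in> {1..n}"
  shows "x t j a > 0"
  using assms(1)
proof (induction t arbitrary: a rule: nat_induct_at_least)
  case base
  show ?case using d_pos[OF assms(2)] by simp
next
  case (Suc t)
  have "(\<Sum>b\<in>{1..d j}. x t j b * exp (u t j b)) > 0"
    using d_pos[OF assms(2)] by (intro sum_pos mult_pos_pos Suc.IH exp_gt_zero) auto
  then show ?case unfolding x_Suc[OF Suc(1)] by (simp add: Suc)
qed

lemma x_sum:
  assumes "t \<ge> 1" "j \<in> {1..n}"
  shows "(\<Sum>a\<in>{1..d j}. x t j a) = 1"
  using assms(1)
proof (induction t rule: nat_induct_at_least)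
  case base
  show ?case using d_pos[OF assms(2)] by simp
next
  case (Suc t)
  have "(\<Sum>b\<in>{1..d j}. x t j b * exp (u t j b)) > 0"
    using d_pos[OF assms(2)] by (intro sum_pos mult_pos_pos x_pos[OF Suc(1) assms(2)] exp_gt_zero) auto
  then show ?case unfolding x_Suc[OF Suc(1)] by (simp flip: sum_divide_distrib)
qed

lemma L_bounds:
  assumes "j \<in> {1..n}" "a \<in> {1..d j}" "p \<in> PiE ({1..n} - {j}) (\<lambda>j. {1..d j})"
  shows "L j (p(j := a)) \<in> {0..1}"
proof -
  have "p(j := a) \<in> PiE {1..n} (\<lambda>j. {1..d j})"
    using assms by (auto simp: PiE_iff extensional_def)
  then show ?thesis using game assms(1) unfolding is_game_def by blast
qed

lemma l_bounds:
  assumes "j \<in> {1..n}" "a \<in> {1..d j}"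
  shows "l t j a \<in> {0..1}"
proof (cases t)
  case (Suc t')
  let ?P = "PiE ({1..n} - {j}) (\<lambda>j. {1..d j})"
  let ?w = "\<lambda>p. \<Prod>k\<in>{1..n} - {j}. x t k (p k)"
  have t: "t \<ge> 1" using Suc by simp
  have l: "l t j a = (\<Sum>p\<in>?P. L j (p(j := a)) * ?w p)"
    unfolding Suc by (simp add: expected_loss_def)
  have w: "?w p \<ge> 0" for p
    by (intro prod_nonneg less_imp_le x_pos[OF t]) auto
  have "(\<Sum>p\<in>?P. ?w p) = (\<Prod>k\<in>{1..n} - {j}. \<Sum>a\<in>{1..d k}. x t k a)"
    by (rule prod_sum_PiE[symmetric]) auto
  also have "\<dots> = 1" using x_sum[OF t] by simp
  finally have s: "(\<Sum>p\<in>?P. ?w p) = 1" .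
  have "l t j a \<ge> 0"
    unfolding l using L_bounds[OF assms] w by (intro sum_nonneg mult_nonneg_nonneg) auto
  moreover have "l t j a \<le> (\<Sum>p\<in>?P. 1 * ?w p)"
    unfolding l using L_bounds[OF assms] w by (intro sum_mono mult_right_mono) auto
  ultimately show ?thesis using s by simp
qed simp

section \<open>Strategies and losses in terms of log-weights from a base round\<close>

definition V :: "nat \<Rightarrow> nat \<times> nat \<Rightarrow> nat \<Rightarrow> real" where
  "V t = (\<lambda>(j, a) s. \<Sum>r<s. u (t + r) j a)"

text \<open>The normaliser (partition function) of the weights \<open>exp V\<close> relative to the
  strategy at round \<open>t\<close>.\<close>

definition Z :: "nat \<Rightarrow> nat \<Rightarrow> nat \<Rightarrow> real" where
  "Z t j s = (\<Sum>a\<in>{1..d j}. x t j a * exp (V t (j, a) s))"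

lemma Z_pos:
  assumes "t \<ge> 1" "j \<in> {1..n}"
  shows "Z t j s > 0"
  unfolding Z_def using d_pos[OF assms(2)] by (intro sum_pos mult_pos_pos x_pos[OF assms] exp_gt_zero) auto

text \<open>The normalisations of the intermediate rounds cancel, so \<open>s\<close> updates amount
  to one exponential reweighting of the strategy at round \<open>t\<close>.\<close>

lemma x_add:
  assumes "t \<ge> 1" "j \<in> {1..n}"
  shows "x (t + s) j a = x t j a * exp (V t (j, a) s) / Z t j s"
proof (induction s arbitrary: a)
  case 0
  show ?case using x_sum[OF assms] by (simp add: V_def Z_def)
next
  case (Suc s)
  let ?y = "\<lambda>a. x t j a * exp (V t (j, a) (Suc s))"
  have y: "x (t + s) j a * exp (u (t + s) j a) = ?y a / Z t j s" for a
    unfolding Suc by (simp add: V_def exp_add)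
  have "x (t + Suc s) j a = (?y a / Z t j s) / (\<Sum>b\<in>{1..d j}. ?y b / Z t j s)"
    using x_Suc[of "t + s" j a] assms(1) unfolding y by simp
  also have "\<dots> = ?y a / Z t j (Suc s)"
    using Z_pos[OF assms, of s] by (simp add: Z_def flip: sum_divide_distrib)
  finally show ?case .
qed

text \<open>\<open>Z - 1\<close> is the average of \<open>exp V - 1\<close> under the strategy at
  round \<open>t\<close>, because that strategy sums to 1; \<open>2 * \<epsilon> \<le> 1 / 2\<close>
  then permits the Neumann series for \<open>1 / Z\<close>.\<close>

lemma
  assumes V: "fdiff_bound K \<rho> actions (V t) \<epsilon>" and "\<rho> > 0" "\<epsilon> \<le> 1 / 4" "t \<ge> 1"
  shows fdiff_bound_Z: "fdiff_bound K \<rho> {1..n} (\<lambda>j s. Z t j s - 1) (2 * \<epsilon>)"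
    and fdiff_bound_inverse_Z: "fdiff_bound K \<rho> {1..n} (\<lambda>j s. 1 / Z t j s) 2"
proof -
  have e: "fdiff_bound K \<rho> actions (\<lambda>i s. exp (V t i s) - 1) (2 * \<epsilon>)"
    by (rule fdiff_bound_exp[OF V]) (use assms in auto)
  have "fdiff_bound K \<rho> {1..n} (\<lambda>j s. \<Sum>a\<in>{1..d j}. x t j a * (exp (V t (j, a) s) - 1)) (2 * \<epsilon>)"
    by (rule fdiff_bound_average[OF e])
      (use assms x_sum in \<open>auto intro: less_imp_le[OF x_pos]\<close>)
  then show *: "fdiff_bound K \<rho> {1..n} (\<lambda>j s. Z t j s - 1) (2 * \<epsilon>)"
    by (rule fdiff_bound_reindex)
      (use x_sum[OF assms(4)] in \<open>auto simp: Z_def right_diff_distrib sum_subtractf\<close>)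
  show "fdiff_bound K \<rho> {1..n} (\<lambda>j s. 1 / Z t j s) 2"
    by (rule fdiff_bound_inverse[OF *]) (use assms in auto)
qed

text \<open>The relative change equals \<open>((exp V - 1) - (Z - 1)) / Z\<close>: two terms of norm
  \<open>2 * \<epsilon>\<close> each, times 2 for \<open>1 / Z\<close>.\<close>

lemma fdiff_bound_ratio:
  assumes V: "fdiff_bound K \<rho> actions (V t) \<epsilon>" and "\<rho> > 0" "\<epsilon> \<le> 1 / 4" "t \<ge> 1"
  shows "fdiff_bound K \<rho> actions (\<lambda>(j, a) s. x (t + s) j a / x t j a - 1) (8 * \<epsilon>)"
proof -
  have e: "fdiff_bound K \<rho> actions (\<lambda>i s. exp (V t i s) - 1) (2 * \<epsilon>)"
    by (rule fdiff_bound_exp[OF V]) (use assms in auto)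
  have z: "fdiff_bound K \<rho> actions (\<lambda>i s. Z t (fst i) s - 1) (2 * \<epsilon>)"
    by (rule fdiff_bound_reindex[OF fdiff_bound_Z[OF assms], where h = fst]) auto
  have iz: "fdiff_bound K \<rho> actions (\<lambda>i s. 1 / Z t (fst i) s) 2"
    by (rule fdiff_bound_reindex[OF fdiff_bound_inverse_Z[OF assms], where h = fst]) auto
  have "fdiff_bound K \<rho> actions
      (\<lambda>i s. (exp (V t i s) - 1 - (Z t (fst i) s - 1)) * (1 / Z t (fst i) s)) ((2 * \<epsilon> + 2 * \<epsilon>) * 2)"
    by (intro fdiff_bound_mult fdiff_bound_diff e z iz assms)
  then have "fdiff_bound K \<rho> actions (\<lambda>(j, a) s. x (t + s) j a / x t j a - 1) ((2 * \<epsilon> + 2 * \<epsilon>) * 2)"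
  proof (rule fdiff_bound_reindex[where h = id])
    fix i s assume "i \<in> actions"
    then obtain j a where i: "i = (j, a)" "j \<in> {1..n}" by auto
    show "(case i of (j, a) \<Rightarrow> \<lambda>s. x (t + s) j a / x t j a - 1) s =
        (exp (V t (id i) s) - 1 - (Z t (fst (id i)) s - 1)) * (1 / Z t (fst (id i)) s)"
      unfolding i(1) prod.case id_apply fst_conv x_add[OF assms(4) i(2)]
      using x_pos[OF assms(4) i(2), of a] Z_pos[OF assms(4) i(2), of s] by (simp add: field_simps)
  qed simp
  then show ?thesis by simp
qed

text \<open>Relative changes have mean zero since strategies at both rounds sum to 1, so the
  orthogonal expansion applies. The assumption \<open>eps\<close> is its condition
  \<open>sqrt (card J) * c \<le> 1 / 2\<close> with \<open>c = 8 * \<epsilon>\<close>.\<close>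

lemma fdiff_bound_loss:
  assumes V: "fdiff_bound K \<rho> actions (V t) \<epsilon>" and "\<rho> > 0" "\<epsilon> \<le> 1 / 4" "t \<ge> 1"
    and eps: "16 * sqrt (real n) * \<epsilon> \<le> 1"
  shows "fdiff_bound K \<rho> actions (\<lambda>(j, a) s. l (t + s) j a) 2"
proof -
  let ?f = "\<lambda>(j, a) s. x (t + s) j a / x t j a - 1"
  have mean: "(\<Sum>a\<in>{1..d j}. x t j a * ?f (j, a) s) = 0" if "j \<in> {1..n}" for j s
  proof -
    have "(\<Sum>a\<in>{1..d j}. x t j a * ?f (j, a) s) = (\<Sum>a\<in>{1..d j}. x (t + s) j a - x t j a)"
      using x_pos[OF assms(4) that] by (intro sum.cong refl) (simp add: field_simps less_imp_neq[symmetric])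
    then show ?thesis
      using x_sum[of "t + s" j] x_sum[of t j] assms(4) that by (simp add: sum_subtractf)
  qed
  have "fdiff_bound K \<rho> actions
    (\<lambda>i s. \<Sum>p\<in>PiE ({1..n} - {fst i}) (\<lambda>j. {1..d j}). L (fst i) (p(fst i := snd i)) *
      (\<Prod>j\<in>{1..n} - {fst i}. x t j (p j) * (?f (j, p j) s + 1))) 2"
  proof (rule fdiff_bound_expectation[where f = ?f and w = "x t", OF _ _ _ _ mean fdiff_bound_ratio[OF assms(1-4)] assms(2)])
    show "0 \<le> x t j a" if "j \<in> {1..n}" for j a
      by (rule less_imp_le[OF x_pos[OF assms(4) that]])
    show "(\<Sum>a\<in>{1..d j}. x t j a) = 1" if "j \<in> {1..n}" for j
      by (rule x_sum[OF assms(4) that])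
    show "\<bar>L (fst i) (p(fst i := snd i))\<bar> \<le> 1"
      if "i \<in> actions" "p \<in> PiE ({1..n} - {fst i}) (\<lambda>j. {1..d j})" for i p
      using L_bounds[of "fst i" "snd i" p] that by auto
  qed (use eps in auto)
  then show ?thesis
  proof (rule fdiff_bound_reindex[where h = id])
    fix i s assume "i \<in> actions"
    then obtain j a where i: "i = (j, a)" "j \<in> {1..n}" by auto
    have "x t k b * (?f (k, b) s + 1) = x (t + s) k b" if "k \<in> {1..n}" for k b
      using x_pos[OF assms(4) that, of b] by simp
    \<comment> \<open>All rounds \<open>t + s\<close> are at least 1; the prescribed zero loss of
      round 0, which need not be an expected loss, stays outside the window.\<close>
    moreover have "l (t + s) j a = expected_loss n d L (x (t + s)) j a"
      using assms(4) by (cases "t + s") auto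
    ultimately show "(case i of (j, a) \<Rightarrow> \<lambda>s. l (t + s) j a) s =
        (\<Sum>p\<in>PiE ({1..n} - {fst (id i)}) (\<lambda>j. {1..d j}). L (fst (id i)) (p(fst (id i) := snd (id i))) *
      (\<Prod>j\<in>{1..n} - {fst (id i)}. x t j (p j) * (?f (j, p j) s + 1)))"
      by (simp add: i(1) expected_loss_def)
  qed simp
qed

lemma u_bound:
  assumes "(j, a) \<in> actions"
  shows "\<bar>u t j a\<bar> \<le> 2 * \<eta>"
proof -
  have "\<bar>2 * l t j a - l (t - 1) j a\<bar> \<le> 2"
    using l_bounds[of j a t] l_bounds[of j a "t - 1"] assms by auto
  from mult_left_mono[OF this, of \<eta>] show ?thesis
    using eta_pos by (simp add: u_def abs_mult)
qed

lemma V_bound: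
  assumes "i \<in> actions"
  shows "\<bar>V t i s\<bar> \<le> 2 * \<eta> * real s"
proof -
  obtain j a where i: "i = (j, a)" by (cases i)
  have "\<bar>V t i s\<bar> \<le> (\<Sum>r<s. \<bar>u (t + r) j a\<bar>)"
    unfolding i V_def by simp
  also have "\<dots> \<le> (\<Sum>r<s. 2 * \<eta>)"
    using assms i by (intro sum_mono u_bound) simp
  finally show ?thesis by (simp add: mult_ac)
qed

text \<open>The radius makes \<open>6 * \<eta> * \<rho>\<close> equal to
  \<open>1 / (32 * sqrt n)\<close>, which is half of the target \<open>\<epsilon>\<close> below. The
  other half is left for the pointwise size of \<open>V\<close>.\<close>

definition \<rho> :: real where "\<rho> = 1 / (192 * sqrt (real n) * \<eta>)"

definition \<epsilon> :: real where "\<epsilon> = 1 / (16 * sqrt (real n))"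

lemma rho_pos: "\<rho> > 0"
  using eta_pos n_pos by (simp add: \<rho>_def)

lemma eps_le: "\<epsilon> \<le> 1 / 16" "16 * sqrt (real n) * \<epsilon> \<le> 1"
  using n_pos by (auto simp: \<epsilon>_def field_simps)

text \<open>A bootstrap: a bound for \<open>V\<close> on a window bounds the losses there, hence the
  increments of \<open>V\<close>, hence \<open>V\<close> on a window longer by one. The optimistic
  term reads the previous round, so each step moves the base round back by one;
  \<open>t \<ge> K + 1\<close> keeps it at least 1.\<close>

lemma fdiff_bound_V:
  assumes "64 * sqrt (real n) * \<eta> * real K \<le> 1" "t \<ge> K + 1"
  shows "fdiff_bound K \<rho> actions (V t) \<epsilon>"
  using assms
proof (induction K arbitrary: t)
  case 0
  have "fdiff_majorant 0 \<rho> (V t i) (\<lambda>k. 0)" for i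
    by (auto simp: fdiff_majorant_def V_def split: prod.splits)
  moreover have "0 \<le> \<epsilon>" by (simp add: \<epsilon>_def)
  ultimately show ?case
    by (intro fdiff_boundI[where \<alpha> = "\<lambda>k. 0"]) auto
next
  case (Suc K)
  have sn: "sqrt (real n) > 0" using n_pos by simp
  have "64 * sqrt (real n) * \<eta> * real K \<le> 64 * sqrt (real n) * \<eta> * real (Suc K)"
    using eta_pos by (intro mult_left_mono) auto
  then have K: "64 * sqrt (real n) * \<eta> * real K \<le> 1"
    using Suc.prems(1) by (rule order_trans)
  \<comment> \<open>Used at \<open>t\<close> and at \<open>t - 1\<close>, for the current and the
    previous loss in the update.\<close>
  have loss: "fdiff_bound K \<rho> actions (\<lambda>(j, a) s. l (t' + s) j a) 2" if "t' \<ge> K + 1" for t'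
    by (rule fdiff_bound_loss[OF Suc.IH]) (use that K rho_pos eps_le in auto)
  have "fdiff_bound K \<rho> actions
      (\<lambda>i s. - \<eta> * (2 * (\<lambda>(j, a) s. l (t + s) j a) i s - (\<lambda>(j, a) s. l (t - 1 + s) j a) i s))
      (\<bar>- \<eta>\<bar> * (\<bar>2\<bar> * 2 + 2))"
    by (intro fdiff_bound_cmult fdiff_bound_diff loss rho_pos) (use Suc.prems in auto)
  then have "fdiff_bound K \<rho> actions (\<lambda>i. fdiff (V t i)) (\<bar>- \<eta>\<bar> * (\<bar>2\<bar> * 2 + 2))"
    by (rule fdiff_bound_reindex[where h = id])
      (use Suc.prems in \<open>auto simp: fdiff_def V_def u_def\<close>)
  then have "fdiff_bound (Suc K) \<rho> actions (V t)
      (2 * \<eta> * real (Suc K) + \<rho> * (\<bar>- \<eta>\<bar> * (\<bar>2\<bar> * 2 + 2)))"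
  proof (rule fdiff_bound_step)
    fix i s assume i: "i \<in> actions" "s \<le> Suc K"
    have "\<bar>V t i s\<bar> \<le> 2 * \<eta> * real s" by (rule V_bound[OF i(1)])
    also have "\<dots> \<le> 2 * \<eta> * real (Suc K)"
      using i(2) eta_pos by (intro mult_left_mono) auto
    finally show "\<bar>V t i s\<bar> \<le> 2 * \<eta> * real (Suc K)" .
  qed (use rho_pos eta_pos in auto)
  moreover have "2 * \<eta> * real (Suc K) + \<rho> * (\<bar>- \<eta>\<bar> * (\<bar>2\<bar> * 2 + 2)) \<le> \<epsilon>"
  proof -
    have "2 * \<eta> * real (Suc K) \<le> 1 / (32 * sqrt (real n))"
      using Suc.prems(1) sn by (simp add: field_simps)
    moreover have "\<rho> * (\<bar>- \<eta>\<bar> * (\<bar>2\<bar> * 2 + 2)) = 1 / (32 * sqrt (real n))"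
      using sn eta_pos by (simp add: \<rho>_def field_simps)
    ultimately show ?thesis using sn by (simp add: \<epsilon>_def field_simps)
  qed
  ultimately show ?case by (rule fdiff_bound_mono)
qed

section \<open>Norms and differences of the weighted gaps\<close>

lemma sum_action_pairs_le:
  assumes "t \<ge> 1" "i \<in> {1..n}"
  shows "(\<Sum>(a, b)\<in>action_pairs d i. x t i a * x t i b) \<le> 1"
proof -
  have "(\<Sum>(a, b)\<in>action_pairs d i. x t i a * x t i b) \<le>
      (\<Sum>(a, b)\<in>{1..d i} \<times> {1..d i}. x t i a * x t i b)"
    by (rule sum_mono2)
      (use x_pos[OF assms] in \<open>auto simp: action_pairs_def intro: less_imp_le\<close>)
  also have "\<dots> = (\<Sum>a\<in>{1..d i}. x t i a) * (\<Sum>b\<in>{1..d i}. x t i b)"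
    by (simp only: sum_product sum.cartesian_product)
  also have "\<dots> = 1"
    by (simp only: x_sum[OF assms] mult_1)
  finally show ?thesis .
qed

text \<open>The squared weights \<open>x t i a * x t i b\<close> have total mass at most 1, so an
  entrywise bound carrying this weight becomes a norm bound independent of the number of
  actions.\<close>

lemma L2_set_action_pairs_le:
  assumes "t \<ge> 1" "i \<in> {1..n}" "c \<ge> 0"
    "\<And>a b. (a, b) \<in> action_pairs d i \<Longrightarrow> \<bar>h (a, b)\<bar> \<le> sqrt (x t i a * x t i b) * c"
  shows "L2_set h (action_pairs d i) \<le> c"
proof -
  have "(\<Sum>p\<in>action_pairs d i. (h p)\<^sup>2) \<le> (\<Sum>(a, b)\<in>action_pairs d i. x t i a * x t i b * c\<^sup>2)"
  proof (rule sum_mono, clarify)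
    fix a b assume "(a, b) \<in> action_pairs d i"
    from power_mono[OF assms(4)[OF this] abs_ge_zero, of 2]
    show "(h (a, b))\<^sup>2 \<le> x t i a * x t i b * c\<^sup>2"
      using x_pos[OF assms(1,2)] by (simp add: power_mult_distrib less_imp_le)
  qed
  also have "\<dots> = (\<Sum>(a, b)\<in>action_pairs d i. x t i a * x t i b) * c\<^sup>2"
    by (simp add: sum_distrib_right case_prod_unfold)
  also have "\<dots> \<le> 1 * c\<^sup>2"
    by (intro mult_right_mono sum_action_pairs_le assms) simp
  finally show ?thesis
    unfolding L2_set_def using assms(3) by (intro real_le_lsqrt) (auto intro: sum_nonneg)
qed

text \<open>The constant \<open>sqrt (x t i a * x t i b)\<close> at the base round factors out of
  the gap. What remains is \<open>exp\<close> of the mean of two log-weights, times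
  \<open>1 / Z\<close>, times a loss difference; their norms 2, 2 and \<open>2 + 2\<close> multiply
  to 16.\<close>

lemma fdiff_weighted_gap_le_regular:
  assumes "i \<in> {1..n}" "64 * sqrt (real n) * \<eta> * real k \<le> 1" "t \<ge> k + 2"
  shows "L2_set ((fdiff ^^ k) (weighted_gap n d L \<eta> i) t) (action_pairs d i) \<le> 16 * fact k / \<rho> ^ k"
proof (rule L2_set_action_pairs_le[of t])
  show t: "t \<ge> 1" using assms(3) by simp
  show "0 \<le> 16 * fact k / \<rho> ^ k" using rho_pos by simp
  fix a b assume ab: "(a, b) \<in> action_pairs d i"
  let ?U = "{()}"
  have V: "fdiff_bound k \<rho> actions (V t) \<epsilon>"
    by (rule fdiff_bound_V) (use assms in auto)
  have Va: "fdiff_bound k \<rho> ?U (\<lambda>_. V t (i, a)) \<epsilon>" "fdiff_bound k \<rho> ?U (\<lambda>_. V t (i, b)) \<epsilon>"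
    by (rule fdiff_bound_reindex[OF V, where h = "\<lambda>_. (i, a)"]
          fdiff_bound_reindex[OF V, where h = "\<lambda>_. (i, b)"];
        use ab assms(1) in \<open>auto simp: action_pairs_def\<close>)+
  \<comment> \<open>The gap pairs a strategy with the loss one round earlier, so the loss window
    starts at \<open>t - 1\<close>; this requires \<open>t \<ge> k + 2\<close>.\<close>
  have l: "fdiff_bound k \<rho> actions (\<lambda>(j, a) s. l (t - 1 + s) j a) 2"
    by (rule fdiff_bound_loss[OF fdiff_bound_V]) (use assms rho_pos eps_le in auto)
  have la: "fdiff_bound k \<rho> ?U (\<lambda>_ s. l (t - 1 + s) i a) 2" "fdiff_bound k \<rho> ?U (\<lambda>_ s. l (t - 1 + s) i b) 2"
    by (rule fdiff_bound_reindex[OF l, where h = "\<lambda>_. (i, a)"]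
          fdiff_bound_reindex[OF l, where h = "\<lambda>_. (i, b)"];
        use ab assms(1) in \<open>auto simp: action_pairs_def\<close>)+
  have "fdiff_bound k \<rho> ?U (\<lambda>_ s. (1 / 2) * V t (i, a) s + (1 / 2) * V t (i, b) s) (\<bar>1 / 2\<bar> * \<epsilon> + \<bar>1 / 2\<bar> * \<epsilon>)"
    by (intro fdiff_bound_add fdiff_bound_cmult Va rho_pos)
  then have "fdiff_bound k \<rho> ?U (\<lambda>_ s. exp ((1 / 2) * V t (i, a) s + (1 / 2) * V t (i, b) s) - 1)
      (2 * (\<bar>1 / 2\<bar> * \<epsilon> + \<bar>1 / 2\<bar> * \<epsilon>))"
    by (rule fdiff_bound_exp) (use rho_pos eps_le in auto)
  from fdiff_bound_add[OF this fdiff_bound_const[where c = 1 and f = "\<lambda>_ _. 1"] rho_pos]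
  have e: "fdiff_bound k \<rho> ?U (\<lambda>_ s. exp ((1 / 2) * V t (i, a) s + (1 / 2) * V t (i, b) s)) 2"
    by (rule fdiff_bound_mono[OF fdiff_bound_reindex[where h = id]]) (use eps_le in auto)
  have z: "fdiff_bound k \<rho> ?U (\<lambda>_ s. 1 / Z t i s) 2"
    by (rule fdiff_bound_reindex[OF fdiff_bound_inverse_Z[OF V rho_pos _ t], where h = "\<lambda>_. i"])
      (use eps_le assms(1) in auto)
  define g where "g s = exp ((1 / 2) * V t (i, a) s + (1 / 2) * V t (i, b) s) * (1 / Z t i s) *
    (l (t - 1 + s) i a - l (t - 1 + s) i b)" for s
  have "fdiff_bound k \<rho> ?U (\<lambda>_. g) (2 * 2 * (2 + 2))"
    unfolding g_def by (intro fdiff_bound_mult fdiff_bound_diff e z la rho_pos)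
  from fdiff_bound_le[OF this, of "()" 0 k] have g: "\<bar>(fdiff ^^ k) g 0\<bar> \<le> 16 * fact k / \<rho> ^ k"
    using rho_pos by simp
  have gap: "weighted_gap n d L \<eta> i (s + t) (a, b) = sqrt (x t i a * x t i b) * g s" for s
  proof -
    let ?w = "exp ((1 / 2) * V t (i, a) s + (1 / 2) * V t (i, b) s)"
    have "exp (V t (i, a) s) * exp (V t (i, b) s) = ?w\<^sup>2"
      by (simp add: power2_eq_square flip: exp_add)
    then have "x (t + s) i a * x (t + s) i b = (x t i a * x t i b) * (?w * (1 / Z t i s))\<^sup>2"
      unfolding x_add[OF t assms(1)] power_mult_distrib
      by (simp add: power2_eq_square mult_ac)
    then have "sqrt (x (t + s) i a * x (t + s) i b) = sqrt (x t i a * x t i b) * (?w * (1 / Z t i s))"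
      using Z_pos[OF t assms(1), of s] by (simp add: real_sqrt_mult)
    then show ?thesis
      using t unfolding weighted_gap_def g_def by (simp add: add.commute mult_ac)
  qed
  have "(fdiff ^^ k) (weighted_gap n d L \<eta> i) t (a, b) =
      (fdiff ^^ k) (\<lambda>s. weighted_gap n d L \<eta> i (s + t) (a, b)) 0"
    by (simp add: fdiff_pow_apply fdiff_pow_shift[of k "\<lambda>r. weighted_gap n d L \<eta> i r (a, b)" t 0])
  also have "\<dots> = sqrt (x t i a * x t i b) * (fdiff ^^ k) g 0"
    unfolding gap by (rule fdiff_pow_cmult)
  finally show "\<bar>(fdiff ^^ k) (weighted_gap n d L \<eta> i) t (a, b)\<bar> \<le>
      sqrt (x t i a * x t i b) * (16 * fact k / \<rho> ^ k)"
    using mult_left_mono[OF g, of "sqrt (x t i a * x t i b)"] x_pos[OF t assms(1)]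
    by (simp add: abs_mult less_imp_le)
qed (rule assms(1))

text \<open>The gap vector itself has norm at most 1, and each difference at most doubles the bound
  by the triangle inequality.\<close>

lemma fdiff_weighted_gap_le_trivial:
  assumes "i \<in> {1..n}" "t \<ge> 1"
  shows "L2_set ((fdiff ^^ k) (weighted_gap n d L \<eta> i) t) (action_pairs d i) \<le> 2 ^ k"
  using assms(2)
proof (induction k arbitrary: t)
  case 0
  show ?case unfolding funpow_0 power_0
  proof (rule L2_set_action_pairs_le[OF 0 assms(1)])
    fix a b assume ab: "(a, b) \<in> action_pairs d i"
    have "\<bar>l (t - 1) i a - l (t - 1) i b\<bar> \<le> 1"
      using l_bounds[OF assms(1), of a "t - 1"] l_bounds[OF assms(1), of b "t - 1"] ab
      by (auto simp: action_pairs_def)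
    then show "\<bar>weighted_gap n d L \<eta> i t (a, b)\<bar> \<le> sqrt (x t i a * x t i b) * 1"
      unfolding weighted_gap_def using x_pos[OF 0 assms(1)]
      by (simp add: abs_mult mult_left_le less_imp_le)
  qed simp
next
  case (Suc k)
  let ?D = "(fdiff ^^ k) (weighted_gap n d L \<eta> i)"
  have "L2_set ((fdiff ^^ Suc k) (weighted_gap n d L \<eta> i) t) (action_pairs d i) =
      L2_set (\<lambda>p. ?D (t + 1) p + - ?D t p) (action_pairs d i)"
    unfolding fdiff_pow_Suc by (simp add: fun_diff_def)
  also have "\<dots> \<le> L2_set (?D (t + 1)) (action_pairs d i) + L2_set (\<lambda>p. - ?D t p) (action_pairs d i)"
    by (rule L2_set_triangle_ineq)
  also have "L2_set (\<lambda>p. - ?D t p) (action_pairs d i) = L2_set (?D t) (action_pairs d i)"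
    by (simp add: L2_set_def)
  also have "L2_set (?D (t + 1)) (action_pairs d i) + L2_set (?D t) (action_pairs d i) \<le> 2 ^ k + 2 ^ k"
    using Suc by (intro add_mono Suc.IH) auto
  finally show ?case by simp
qed

text \<open>Outside the regular range \<open>sqrt n * \<eta>\<close> exceeds
  \<open>1 / (64 * k)\<close>, so the base \<open>512 * sqrt n * \<eta>\<close> exceeds
  \<open>8 / k\<close>, and then \<open>2 ^ k\<close> is already below the claimed bound.\<close>

lemma fdiff_weighted_gap_le:
  assumes "i \<in> {1..n}" "k \<ge> 1" "t \<ge> k + 2"
  shows "L2_set ((fdiff ^^ k) (weighted_gap n d L \<eta> i) t) (action_pairs d i) \<le>
    16 * (512 * sqrt (real n) * \<eta>) ^ k * fact k"
proof (cases "64 * sqrt (real n) * \<eta> * real k \<le> 1")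
  case True
  have "L2_set ((fdiff ^^ k) (weighted_gap n d L \<eta> i) t) (action_pairs d i) \<le> 16 * fact k / \<rho> ^ k"
    by (rule fdiff_weighted_gap_le_regular) (use True assms in auto)
  also have "\<dots> = 16 * (192 * sqrt (real n) * \<eta>) ^ k * fact k"
    by (simp add: \<rho>_def power_one_over)
  also have "\<dots> \<le> 16 * (512 * sqrt (real n) * \<eta>) ^ k * fact k"
    using eta_pos by (intro mult_right_mono mult_left_mono power_mono) auto
  finally show ?thesis .
next
  case False
  have k: "real k > 0" using assms(2) by simp
  \<comment> \<open>A single term of the exponential series: the half of Stirling's estimate that is
    needed, with \<open>exp 1\<close> rounded up to 4.\<close>
  have "real k ^ k / fact k \<le> exp (real k)"
    using sum_le_suminf[OF summable_exp_generic[of "real k"], of "{k}"]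
    by (simp add: exp_def divide_inverse mult.commute)
  also have "\<dots> = exp 1 ^ k"
    by (simp flip: exp_of_nat_mult)
  also have "\<dots> \<le> 4 ^ k"
    using exp_le by (intro power_mono) auto
  finally have *: "real k ^ k \<le> 4 ^ k * fact k" by (simp add: field_simps)
  have "(8 / real k) ^ k \<le> (512 * sqrt (real n) * \<eta>) ^ k"
    using False k by (intro power_mono) (auto simp: field_simps)
  then have "(8 / real k) ^ k * fact k \<le> (512 * sqrt (real n) * \<eta>) ^ k * fact k"
    by (rule mult_right_mono) simp
  moreover have "2 ^ k \<le> (8 / real k) ^ k * fact k"
  proof -
    have "(2::real) ^ k * real k ^ k \<le> 2 ^ k * (4 ^ k * fact k)"
      using * by (intro mult_left_mono) auto
    also have "\<dots> = 8 ^ k * fact k"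
      by (simp flip: power_mult_distrib mult.assoc)
    finally show ?thesis using k by (simp add: field_simps power_divide)
  qed
  moreover have "L2_set ((fdiff ^^ k) (weighted_gap n d L \<eta> i) t) (action_pairs d i) \<le> 2 ^ k"
    by (rule fdiff_weighted_gap_le_trivial) (use assms in auto)
  moreover have "0 \<le> (512 * sqrt (real n) * \<eta>) ^ k * fact k"
    using eta_pos by simp
  ultimately show ?thesis by linarith
qed

end

theorem lemma5p5:
  "\<exists>C R :: real. C > 0 \<and> R > 0 \<and>
     (\<forall>(n :: nat) (d :: nat \<Rightarrow> nat) (L :: nat \<Rightarrow> (nat \<Rightarrow> nat) \<Rightarrow> real) (\<eta> :: real) (i :: nat) (k :: nat).
        is_game n d L \<longrightarrow> \<eta> > 0 \<longrightarrow> i \<in> {1..n} \<longrightarrow> k \<ge> 1 \<longrightarrow>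
        (SUP t\<in>{k + 2..}. ereal (L2_set ((fdiff ^^ k) (weighted_gap n d L \<eta> i) t) (action_pairs d i)))
          \<le> ereal (C * (R * sqrt (real n) * \<eta>) ^ k * fact k))"
proof (rule exI[of _ 16], rule exI[of _ 512], intro conjI allI impI SUP_least)
  fix n k i t :: nat and d L and \<eta> :: real
  assume "is_game n d L" "\<eta> > 0" and *: "i \<in> {1..n}" "k \<ge> 1" "t \<in> {k + 2..}"
  then interpret optimistic_hedge n d L \<eta> by unfold_locales
  show "ereal (L2_set ((fdiff ^^ k) (weighted_gap n d L \<eta> i) t) (action_pairs d i)) \<le>
      ereal (16 * (512 * sqrt (real n) * \<eta>) ^ k * fact k)"
    using fdiff_weighted_gap_le[of i k t] * by simp
qed simp_all

end
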